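(* Let $F=\mathbb{F}_q$, $K=\mathbb{F}_{q^m}$, $\mathrm{Gal}(K/F)=\langle\sigma\rangle$, $s=(q^m-1)/(q-1)$, and let $\alpha$ be a primitive element of $K$, i.e. $K^\times=\langle\alpha\rangle$. Suppose $m$ is prime and $m\mid(q-1)$, so that $K=F(d)$ where $d$ is a root of an irreducible polynomial $x^m-e\in F[x]$ for some $e\in F^\times$. Let $A=(K/F,\sigma,a)$ for some $a\in K\setminus F$. (i) If $a\neq\lambda d^i$ for any $i\in\{0,\dots,m-1\}$, $\lambda\in F^\times$, then $\mathrm{Aut}_F(A)=\langle G_\alpha\rangle\cong\mathbb{Z}/s\mathbb{Z}$ and all automorphisms of $A$ are inner. (ii) If $m=2$ and $a=\lambda d$ for some $\lambda\in F^\times$, then $\mathrm{Aut}_F(A)$ is the dicyclic group of order $2q+2$. (iii) If $m>2$ and $a=\lambda d^i$ for some $i\in\{1,\dots,m-1\}$, $\lambda\in F^\times$, then $$\mathrm{Aut}_F(A)\cong\mathbb{Z}/\Big(\frac sm\Big)\mathbb{Z}\rtimes_q\mathbb{Z}/(m^2)\mathbb{Z}.$$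
   Context: $K[t;\sigma]$ is the twisted polynomial ring of left polynomials with $tx=\sigma(x)t$ for $x\in K$. For $a\in K\setminus F$, the nonassociative cyclic algebra $A=(K/F,\sigma,a)=K[t;\sigma]/K[t;\sigma](t^m-a)$ is the set of polynomials in $K[t;\sigma]$ of degree $<m$, with multiplication $g\circ h$ the remainder of $gh$ after right division by $f(t)=t^m-a$ (i.e. the unique $r$ of degree $<m$ with $gh=qf+r$). It is a unital nonassociative $F$-algebra. $\mathrm{Aut}_F(A)$ is the group of bijective $F$-linear multiplicative maps $A\to A$. An automorphism $G\in\mathrm{Aut}_F(A)$ is inner if there are $0\neq c\in A$ and a left inverse $c_l\in A$ of $c$ (i.e. $c_l\circ c=1$) with $G(x)=(c_l\circ x)\circ c$ for all $x\in A$. For $c\in K^\times$, $G_c:A\to A$ is the map $\sum_{i=0}^{m-1}x_it^i\mapsto\sum_{i=0}^{m-1}x_ic^{-1}\sigma^i(c)t^i$. The dicyclic group of order $4l$ is $\mathrm{Dic}_l=\langle x,y\mid y^{2l}=1,\ x^2=y^l,\ x^{-1}yx=y^{-1}\rangle$. For an integer $l$ with $l^n\equiv1\bmod s'$, $\mathbb{Z}/s'\mathbb{Z}\rtimes_l\mathbb{Z}/n\mathbb{Z}=\langle x,y\mid x^{s'}=1,\ y^n=1,\ yxy^{-1}=x^l\rangle$. *)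

theory Defs
  imports
    "HOL-Algebra.Bij"
    "HOL-Algebra.Elementary_Groups"
    "HOL-Computational_Algebra.Polynomial_Factorial"
begin

section \<open>Field extensions\<close>

text \<open>A field extension \<open>K/F\<close> is given by an embedding of the field \<open>F\<close> (the type \<open>'f\<close>) into the
  field \<open>K\<close> (the type \<open>'k\<close>). As a subset of \<open>K\<close>, the field \<open>F\<close> is the range of this embedding.\<close>

definition field_embedding :: "('f::field \<Rightarrow> 'k::field) \<Rightarrow> bool" where
  "field_embedding emb \<longleftrightarrow>
     emb 1 = 1 \<and>
     (\<forall>x y. emb (x + y) = emb x + emb y) \<and>
     (\<forall>x y. emb (x * y) = emb x * emb y)"

definition galois_group :: "('f::field \<Rightarrow> 'k::field) \<Rightarrow> ('k \<Rightarrow> 'k) monoid" where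
  "galois_group emb = (BijGroup UNIV)\<lparr>carrier :=
     {\<tau> \<in> Bij UNIV.
        (\<forall>x y. \<tau> (x + y) = \<tau> x + \<tau> y) \<and>
        (\<forall>x y. \<tau> (x * y) = \<tau> x * \<tau> y) \<and>
        (\<forall>c. \<tau> (emb c) = emb c)}\<rparr>"

definition is_subfield :: "'k::field set \<Rightarrow> bool" where
  "is_subfield L \<longleftrightarrow>
     1 \<in> L \<and> (\<forall>x\<in>L. \<forall>y\<in>L. x - y \<in> L \<and> x * y \<in> L) \<and> (\<forall>x\<in>L. inverse x \<in> L)"

definition adjoin :: "('f::field \<Rightarrow> 'k::field) \<Rightarrow> 'k \<Rightarrow> 'k set" where
  "adjoin emb d = \<Inter>{L. is_subfield L \<and> range emb \<subseteq> L \<and> d \<in> L}"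

text \<open>\<open>K = F(d)\<close>, where \<open>d\<close> is a root of the irreducible polynomial \<open>x\<^sup>m - e \<in> F[x]\<close> with
  \<open>e \<in> F\<^sup>\<times>\<close>.\<close>

definition pure_generator ::
  "('f::field \<Rightarrow> 'k::field) \<Rightarrow> nat \<Rightarrow> 'f \<Rightarrow> 'k \<Rightarrow> bool" where
  "pure_generator emb m e d \<longleftrightarrow>
     e \<noteq> 0 \<and>
     irreducible (monom 1 m - [:e:] :: 'f poly) \<and>
     poly (map_poly emb (monom 1 m - [:e:])) d = 0 \<and>
     adjoin emb d = UNIV"

section \<open>Twisted polynomials and nonassociative cyclic algebras\<close>

text \<open>The additive group of \<open>K[t;\<sigma>]\<close> is that of \<open>'k poly\<close>: the polynomial with coefficients \<open>x\<^sub>i\<close>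
  stands for \<open>\<Sum>\<^sub>i x\<^sub>i t\<^sup>i\<close>, with coefficients on the left. Only the product is different: it is the
  biadditive one with \<open>(x t\<^sup>i) (y t\<^sup>j) = x \<sigma>\<^sup>i(y) t\<^sup>i\<^sup>+\<^sup>j\<close>.\<close>

definition twisted_mult :: "('k::field \<Rightarrow> 'k) \<Rightarrow> 'k poly \<Rightarrow> 'k poly \<Rightarrow> 'k poly" where
  "twisted_mult \<sigma> g h =
     (\<Sum>i\<le>degree g. \<Sum>j\<le>degree h. monom (coeff g i * (\<sigma> ^^ i) (coeff h j)) (i + j))"

text \<open>The zero polynomial has \<open>degree 0 = 0\<close>, so for \<open>m > 0\<close> it belongs to the following set.\<close>

definition cyc_carrier :: "nat \<Rightarrow> 'k::field poly set" where
  "cyc_carrier m = {p. degree p < m}"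

definition cyc_mult ::
  "nat \<Rightarrow> ('k::field \<Rightarrow> 'k) \<Rightarrow> 'k \<Rightarrow> 'k poly \<Rightarrow> 'k poly \<Rightarrow> 'k poly" where
  "cyc_mult m \<sigma> a g h =
     (THE r. degree r < m \<and>
        (\<exists>u. twisted_mult \<sigma> g h = twisted_mult \<sigma> u (monom 1 m - [:a:]) + r))"

definition cyc_aut ::
  "('f::field \<Rightarrow> 'k::field) \<Rightarrow> nat \<Rightarrow> ('k \<Rightarrow> 'k) \<Rightarrow> 'k \<Rightarrow> ('k poly \<Rightarrow> 'k poly) monoid" where
  "cyc_aut emb m \<sigma> a = (BijGroup (cyc_carrier m))\<lparr>carrier :=
     {G \<in> Bij (cyc_carrier m).
        (\<forall>x\<in>cyc_carrier m. \<forall>y\<in>cyc_carrier m. G (x + y) = G x + G y) \<and>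
        (\<forall>c. \<forall>x\<in>cyc_carrier m. G (smult (emb c) x) = smult (emb c) (G x)) \<and>
        (\<forall>x\<in>cyc_carrier m. \<forall>y\<in>cyc_carrier m.
           G (cyc_mult m \<sigma> a x y) = cyc_mult m \<sigma> a (G x) (G y))}\<rparr>"

definition is_inner ::
  "nat \<Rightarrow> ('k::field \<Rightarrow> 'k) \<Rightarrow> 'k \<Rightarrow> ('k poly \<Rightarrow> 'k poly) \<Rightarrow> bool" where
  "is_inner m \<sigma> a G \<longleftrightarrow>
     (\<exists>c\<in>cyc_carrier m. \<exists>c_l\<in>cyc_carrier m.
        c \<noteq> 0 \<and> cyc_mult m \<sigma> a c_l c = 1 \<and>
        (\<forall>x\<in>cyc_carrier m. G x = cyc_mult m \<sigma> a (cyc_mult m \<sigma> a c_l x) c))"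

text \<open>The map \<open>G\<^sub>c\<close>, extended by \<open>undefined\<close> outside the algebra, as all elements of \<open>Bij\<close> are.\<close>

definition G_map :: "nat \<Rightarrow> ('k::field \<Rightarrow> 'k) \<Rightarrow> 'k \<Rightarrow> 'k poly \<Rightarrow> 'k poly" where
  "G_map m \<sigma> c =
     (\<lambda>x\<in>cyc_carrier m. \<Sum>i<m. monom (coeff x i * inverse c * (\<sigma> ^^ i) c) i)"

section \<open>Groups given by generators and relations\<close>

text \<open>A word is a list of letters \<open>(g, b)\<close>, where \<open>(g, True)\<close> stands for the generator \<open>g\<close> and
  \<open>(g, False)\<close> for its formal inverse. A relation \<open>l = r\<close> is a pair \<open>(l, r)\<close> of words. Every
  element of the type \<open>'g\<close> is a generator.\<close>

type_synonym 'g word = "('g \<times> bool) list"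

inductive word_eq :: "('g word \<times> 'g word) set \<Rightarrow> 'g word \<Rightarrow> 'g word \<Rightarrow> bool"
  for R where
  refl: "word_eq R u u"
| sym: "word_eq R u v \<Longrightarrow> word_eq R v u"
| trans: "word_eq R u v \<Longrightarrow> word_eq R v w \<Longrightarrow> word_eq R u w"
| cancel: "word_eq R (u @ [(g, b), (g, \<not> b)] @ v) (u @ v)"
| rel: "(l, r) \<in> R \<Longrightarrow> word_eq R (u @ l @ v) (u @ r @ v)"

definition presented_group :: "('g word \<times> 'g word) set \<Rightarrow> 'g word set monoid" where
  "presented_group R =
     \<lparr>carrier = UNIV // {(u, v). word_eq R u v},
      monoid.mult = (\<lambda>A B. {w. \<exists>u\<in>A. \<exists>v\<in>B. word_eq R (u @ v) w}),
      one = {w. word_eq R [] w}\<rparr>"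

definition gen_pow :: "'g \<Rightarrow> int \<Rightarrow> 'g word" where
  "gen_pow g k = replicate (nat \<bar>k\<bar>) (g, 0 \<le> k)"

datatype gen = Gen_x | Gen_y

abbreviation (input) x_pow :: "int \<Rightarrow> gen word" where "x_pow \<equiv> gen_pow Gen_x"
abbreviation (input) y_pow :: "int \<Rightarrow> gen word" where "y_pow \<equiv> gen_pow Gen_y"

definition dicyclic_group :: "nat \<Rightarrow> gen word set monoid" where
  "dicyclic_group l = presented_group
     {(y_pow (2 * int l), []),
      (x_pow 2, y_pow (int l)),
      (x_pow (- 1) @ y_pow 1 @ x_pow 1, y_pow (- 1))}"

text \<open>\<open>\<int>/s'\<int> \<rtimes>\<^sub>l \<int>/n\<int>\<close>, meaningful when \<open>l\<^sup>n \<equiv> 1\<close> modulo \<open>s'\<close>.\<close>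

definition semidirect_cyclic_group :: "nat \<Rightarrow> int \<Rightarrow> nat \<Rightarrow> gen word set monoid" where
  "semidirect_cyclic_group s' l n = presented_group
     {(x_pow (int s'), []),
      (y_pow (int n), []),
      (y_pow 1 @ x_pow 1 @ y_pow (- 1), x_pow l)}"

subsection \<open>A presented group is a group\<close>

lemma word_eq_context: "word_eq R u v \<Longrightarrow> word_eq R (p @ u @ s) (p @ v @ s)"
proof (induction rule: word_eq.induct)
  case (cancel u g b v)
  show ?case using word_eq.cancel[of R "p @ u" g b "v @ s"] by simp
next
  case (rel l r u v)
  then show ?case using word_eq.rel[of l r R "p @ u" "v @ s"] by simp
qed (auto intro: word_eq.intros)

lemma word_eq_append: "word_eq R u u' \<Longrightarrow> word_eq R v v' \<Longrightarrow> word_eq R (u @ v) (u' @ v')"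
  using word_eq_context[of R u u' "[]" v] word_eq_context[of R v v' u' "[]"]
  by (auto intro: word_eq.trans)

lemma word_eq_inverse:
  "word_eq R (map (\<lambda>(g, b). (g, \<not> b)) (rev w) @ w) []"
proof (induction w)
  case (Cons z w)
  obtain g b where z: "z = (g, b)" by force
  show ?case
    using word_eq.cancel[of R "map (\<lambda>(g, b). (g, \<not> b)) (rev w)" g "\<not> b" w] Cons
    by (auto simp: z intro: word_eq.trans)
qed (auto intro: word_eq.refl)

lemma word_class_in_carrier: "{w. word_eq R u w} \<in> carrier (presented_group R)"
  by (auto simp: presented_group_def quotient_def)

lemma carrier_presented_groupE:
  assumes "A \<in> carrier (presented_group R)"
  obtains u where "A = {w. word_eq R u w}"
  using assms by (auto simp: presented_group_def quotient_def)

lemma mult_word_class: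
  "{w. word_eq R u w} \<otimes>\<^bsub>presented_group R\<^esub> {w. word_eq R v w} = {w. word_eq R (u @ v) w}"
  unfolding presented_group_def
  by (auto intro: word_eq.refl word_eq.trans word_eq_append)

lemma word_class_eq_iff: "{w. word_eq R u w} = {w. word_eq R v w} \<longleftrightarrow> word_eq R u v"
  by (auto intro: word_eq.intros)

lemma one_presented_group: "\<one>\<^bsub>presented_group R\<^esub> = {w. word_eq R [] w}"
  by (simp add: presented_group_def)

lemma group_presented_group: "group (presented_group R)"
proof (rule groupI)
  fix A B assume "A \<in> carrier (presented_group R)" "B \<in> carrier (presented_group R)"
  then show "A \<otimes>\<^bsub>presented_group R\<^esub> B \<in> carrier (presented_group R)"
    by (metis carrier_presented_groupE mult_word_class word_class_in_carrier)
next
  fix A B C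
  assume "A \<in> carrier (presented_group R)" "B \<in> carrier (presented_group R)"
    "C \<in> carrier (presented_group R)"
  then show "A \<otimes>\<^bsub>presented_group R\<^esub> B \<otimes>\<^bsub>presented_group R\<^esub> C =
    A \<otimes>\<^bsub>presented_group R\<^esub> (B \<otimes>\<^bsub>presented_group R\<^esub> C)"
    by (elim carrier_presented_groupE) (simp add: mult_word_class)
next
  fix A assume "A \<in> carrier (presented_group R)"
  then obtain u where u: "A = {w. word_eq R u w}" by (rule carrier_presented_groupE)
  show "\<one>\<^bsub>presented_group R\<^esub> \<otimes>\<^bsub>presented_group R\<^esub> A = A"
    by (simp add: u one_presented_group mult_word_class)
  show "\<exists>B\<in>carrier (presented_group R). B \<otimes>\<^bsub>presented_group R\<^esub> A = \<one>\<^bsub>presented_group R\<^esub>"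
    by (rule bexI[OF _ word_class_in_carrier[of R "map (\<lambda>(g, b). (g, \<not> b)) (rev u)"]])
      (simp add: u one_presented_group mult_word_class word_class_eq_iff word_eq_inverse)
qed (simp add: one_presented_group word_class_in_carrier)

end

theory Submission
  imports "HOL-Algebra.Multiplicative_Group" Defs
begin

text \<open>Write \<open>N\<close> for the norm from \<open>K\<close> to \<open>F\<close>; over finite fields \<open>N(k) = k\<^sup>s\<close>.

  The key step describes all automorphisms of \<open>A\<close>. Since \<open>m\<close> is prime and \<open>a \<notin> F\<close>, no nontrivial
  power of \<open>\<sigma>\<close> fixes \<open>a\<close>, and this makes the field of constants \<open>K\<close> the left nucleus of \<open>A\<close>
  (\<open>left_nucleus_eq\<close>). An automorphism therefore restricts to an element \<open>\<tau>\<close> of the Galois group.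
  Applied to the rule \<open>t x = \<sigma>(x) t\<close> it has to send \<open>t\<close> to \<open>k t\<close> for some \<open>k \<in> K\<^sup>\<times>\<close>, and applied to
  \<open>t\<^sup>m\<^sup>-\<^sup>1 t = a\<close> it requires \<open>\<tau>(a) = N(k) a\<close>. Conversely every such pair \<open>(\<tau>, k)\<close> gives an
  automorphism (\<open>carrier_Aut\<close>), and pairs multiply by \<open>(\<tau>, k) (\<tau>', k') = (\<tau> \<tau>', \<tau>(k') k)\<close>.

  The pairs with \<open>\<tau> = id\<close> form the kernel of the norm, a cyclic group of order \<open>s\<close> generated by
  \<open>\<alpha>\<^sup>-\<^sup>1 \<sigma>(\<alpha>)\<close> (\<open>hilbert90_generator\<close>); they are the maps \<open>G\<^sub>c\<close>, which are inner. A pair with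
  \<open>\<tau> \<noteq> id\<close> exists only if \<open>a\<close> is an eigenvector of \<open>\<tau>\<close> with an eigenvalue in \<open>F\<close>. The eigenvectors
  of the Galois group are the multiples \<open>\<lambda> d\<^sup>i\<close>, because \<open>d\<close> is one whose eigenvalue is a primitive
  \<open>m\<close>-th root of unity. This separates case (i) from the others.

  If \<open>a = \<lambda> d\<^sup>i\<close> is an eigenvector, then every \<open>\<tau>\<close> occurs, since the norm is onto \<open>F\<^sup>\<times>\<close>, and the
  group has order \<open>m s\<close>. An extension of the Frobenius map, which acts on the kernel of the norm as
  the \<open>q\<close>-th power, has as its \<open>m\<close>-th power the scaling of \<open>t\<close> by a root of unity \<open>\<zeta> \<noteq> 1\<close> of order
  \<open>m\<close>. For \<open>m = 2\<close> this \<open>\<zeta> = -1\<close> is the element of order \<open>2\<close> in the cyclic group of order \<open>q + 1\<close>,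
  which gives the dicyclic relations. For odd \<open>m\<close> the prime \<open>m\<close> divides \<open>s\<close> exactly once, so the
  extension, of order \<open>m\<^sup>2\<close>, generates a complement to the normal subgroup of order \<open>s / m\<close>.

  That the relations of a presented group suffice is seen by counting: they reduce every word to a
  normal form \<open>x\<^sup>i y\<^sup>j\<close> (\<open>metacyclic_normal_form\<close>), so the presented group is not larger than the
  group of automorphisms onto which it maps.\<close>

(* Polynomials are those of type poly throughout, not the record-based ones of UnivPoly. *)
hide_const (open) UnivPoly.coeff UnivPoly.monom

section \<open>Groups given by generators and relations\<close>

primrec word_value :: "('a, 'b) monoid_scheme \<Rightarrow> ('g \<Rightarrow> 'a) \<Rightarrow> 'g word \<Rightarrow> 'a" where
  "word_value G f [] = \<one>\<^bsub>G\<^esub>"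
| "word_value G f (z # w) =
     (if snd z then f (fst z) else inv\<^bsub>G\<^esub> f (fst z)) \<otimes>\<^bsub>G\<^esub> word_value G f w"

context group
begin

lemma word_value_closed: "range f \<subseteq> carrier G \<Longrightarrow> word_value G f w \<in> carrier G"
  by (induction w) auto

lemma word_value_append:
  "range f \<subseteq> carrier G \<Longrightarrow> word_value G f (u @ v) = word_value G f u \<otimes> word_value G f v"
  by (induction u) (auto simp: m_assoc word_value_closed range_subsetD)

lemma word_value_gen_pow:
  assumes "range f \<subseteq> carrier G"
  shows "word_value G f (gen_pow g k) = f g [^] k"
proof -
  have g: "f g \<in> carrier G" using assms by auto
  have pos: "word_value G f (replicate n (g, True)) = f g [^] n" for n
    using g by (induction n) (simp_all flip: nat_pow_Suc2 del: nat_pow_Suc)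
  have neg: "word_value G f (replicate n (g, False)) = inv (f g [^] n)" for n
    using g by (induction n) (simp_all add: inv_mult_group)
  show ?thesis
  proof (cases "0 \<le> k")
    case True
    then have "f g [^] k = f g [^] nat k" by (simp only: int_pow_def2) simp
    with True show ?thesis by (simp only: gen_pow_def pos abs_of_nonneg)
  next
    case False
    then have "f g [^] k = inv (f g [^] nat \<bar>k\<bar>)" by (simp only: int_pow_def2) simp
    with False show ?thesis by (simp only: gen_pow_def neg)
  qed
qed

text \<open>Word equality is the least congruence that contains the relations and free cancellation,
  and every interpretation in a group respects free cancellation; so only the relations have to be
  checked.\<close>

lemma word_value_cong:
  assumes f: "range f \<subseteq> carrier G"
    and R: "\<And>l r. (l, r) \<in> R \<Longrightarrow> word_value G f l = word_value G f r"
    and "word_eq R u v"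
  shows "word_value G f u = word_value G f v"
  using assms(3)
proof induction
  case (cancel u g b v)
  have "f g \<in> carrier G" using f by auto
  then show ?case
    by (cases b) (simp_all add: word_value_append[OF f] word_value_closed[OF f] flip: m_assoc)
qed (simp_all add: word_value_append[OF f] R)

end

text \<open>Interpreting the generators tautologically, a word stands for its own class. Hence the
  classes of the generators satisfy the relations and generate the group.\<close>

lemma word_value_presented_group:
  "word_value (presented_group R) (\<lambda>g. {w. word_eq R [(g, True)] w}) u = {w. word_eq R u w}"
proof (induction u)
  case Nil
  show ?case by (simp add: one_presented_group)
next
  case (Cons z u)
  interpret P: group "presented_group R" by (rule group_presented_group)
  obtain g b where z: "z = (g, b)" by force
  have "inv\<^bsub>presented_group R\<^esub> {w. word_eq R [(g, True)] w} = {w. word_eq R [(g, False)] w}"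
    by (rule P.inv_equality)
      (auto simp: mult_word_class one_presented_group word_class_in_carrier word_class_eq_iff
        intro: word_eq.cancel[of R "[]" g False "[]", simplified])
  then show ?case by (auto simp: z Cons mult_word_class)
qed

lemma relation_in_presented_group:
  assumes "(l, r) \<in> R"
  shows "word_value (presented_group R) (\<lambda>g. {w. word_eq R [(g, True)] w}) l =
    word_value (presented_group R) (\<lambda>g. {w. word_eq R [(g, True)] w}) r"
  using word_eq.rel[OF assms, of "[]" "[]"]
  by (simp add: word_value_presented_group word_class_eq_iff)

lemma (in group) word_value_in_generate: "word_value G f w \<in> generate G (range f)"
  by (induction w) (auto intro: generate.intros)

text \<open>By von Dyck's theorem the interpretation of the generators extends to a homomorphism from the
  presented group, which is onto because the images generate. A surjection from a set that is not
  larger than its finite target is a bijection, so an upper bound for the order of the presented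
  group is all that is left to find.\<close>

lemma (in group) presented_group_iso:
  assumes fin: "finite (carrier G)"
    and f: "range f \<subseteq> carrier G" "generate G (range f) = carrier G"
    and R: "\<And>l r. (l, r) \<in> R \<Longrightarrow> word_value G f l = word_value G f r"
    and bound: "finite (carrier (presented_group R))" "card (carrier (presented_group R)) \<le> Coset.order G"
  shows "G \<cong> presented_group R"
proof -
  let ?P = "presented_group R"
  interpret P: group ?P by (rule group_presented_group)
  define h where "h A = word_value G f (SOME w. w \<in> A)" for A
  have h: "h {w. word_eq R u w} = word_value G f u" for u
  proof -
    have "(SOME w. w \<in> {w. word_eq R u w}) \<in> {w. word_eq R u w}"
      by (rule someI[of _ u]) (simp add: word_eq.refl)
    then show ?thesis
      using word_value_cong[OF f(1) R] by (auto simp: h_def)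
  qed
  have hom: "h \<in> hom ?P G"
  proof (rule homI)
    fix A B assume "A \<in> carrier ?P" "B \<in> carrier ?P"
    then obtain u v where "A = {w. word_eq R u w}" "B = {w. word_eq R v w}"
      by (auto elim!: carrier_presented_groupE)
    then show "h (A \<otimes>\<^bsub>?P\<^esub> B) = h A \<otimes> h B"
      by (simp add: mult_word_class h word_value_append[OF f(1)])
  qed (auto elim!: carrier_presented_groupE simp: h word_value_closed[OF f(1)])
  interpret h: group_hom ?P G h
    using hom by unfold_locales auto
  have "range f \<subseteq> h ` carrier ?P"
  proof
    fix z assume "z \<in> range f"
    then obtain g where "z = f g" by auto
    then have "z = h {w. word_eq R [(g, True)] w}" using f(1) by (simp add: h range_subsetD)
    then show "z \<in> h ` carrier ?P" using word_class_in_carrier by blast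
  qed
  then have "carrier G \<subseteq> h ` carrier ?P"
    using generate_subgroup_incl[OF _ h.img_is_subgroup] f(2) by blast
  then have surj: "h ` carrier ?P = carrier G" by auto
  have "inj_on h (carrier ?P)"
    using bound surj card_image_le[OF bound(1), of h]
    by (intro eq_card_imp_inj_on) (auto simp: Coset.order_def)
  then have "h \<in> iso ?P G"
    using hom surj by (simp add: iso_def bij_betw_def)
  then show ?thesis using P.iso_sym is_isoI by blast
qed

context group
begin

text \<open>The relation \<open>y x = x\<^sup>l y\<close> moves every \<open>y\<close> to the right of every \<open>x\<close>, and the two power
  relations then bound the exponents. The shape \<open>y\<^sup>n = x\<^sup>c\<close> covers both the semidirect product
  (\<open>c = 0\<close>) and the dicyclic group, where the square of one generator is a power of the other.\<close>

lemma metacyclic_normal_form: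
  fixes a n c l :: nat
  assumes x: "x \<in> carrier G" and y: "y \<in> carrier G"
    and a: "0 < a" and n: "0 < n"
    and xa: "x [^] a = \<one>" and yn: "y [^] n = x [^] c" and yx: "y \<otimes> x = x [^] l \<otimes> y"
  shows "generate G {x, y} \<subseteq> (\<lambda>(i, j). x [^] i \<otimes> y [^] j) ` ({..<a} \<times> {..<n})"
proof -
  note xy = x y
  have yxi: "y \<otimes> x [^] i = x [^] (l * i) \<otimes> y" for i
  proof (induction i)
    case (Suc i)
    have "y \<otimes> x [^] Suc i = (y \<otimes> x [^] i) \<otimes> x" using xy by (simp add: m_assoc)
    also have "\<dots> = x [^] (l * i) \<otimes> (y \<otimes> x)" using xy by (simp add: Suc m_assoc)
    also have "\<dots> = x [^] (l * Suc i) \<otimes> y"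
      using xy by (simp add: yx nat_pow_mult add.commute flip: m_assoc)
    finally show ?case .
  qed (use xy in simp)
  have yjxi: "y [^] j \<otimes> x [^] i = x [^] (l ^ j * i) \<otimes> y [^] j" for i j :: nat
  proof (induction j arbitrary: i)
    case (Suc j)
    have "y [^] Suc j \<otimes> x [^] i = y [^] j \<otimes> (y \<otimes> x [^] i)" using xy by (simp add: m_assoc)
    also have "\<dots> = (y [^] j \<otimes> x [^] (l * i)) \<otimes> y" using xy by (simp add: yxi m_assoc)
    also have "\<dots> = x [^] (l ^ Suc j * i) \<otimes> y [^] Suc j"
      using xy by (simp add: Suc m_assoc ac_simps)
    finally show ?case .
  qed (use xy in simp)
  have pow_x: "x [^] i = x [^] (i mod a)" for i :: nat
  proof -
    have "x [^] (a * (i div a) + i mod a) = (x [^] a) [^] (i div a) \<otimes> x [^] (i mod a)"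
      using x by (simp add: nat_pow_mult nat_pow_pow)
    then show ?thesis using x xa by simp
  qed
  have reduce: "x [^] i \<otimes> y [^] j \<in> (\<lambda>(i, j). x [^] i \<otimes> y [^] j) ` ({..<a} \<times> {..<n})"
    for i j :: nat
  proof -
    have "y [^] (n * (j div n) + j mod n) = (y [^] n) [^] (j div n) \<otimes> y [^] (j mod n)"
      using y by (simp add: nat_pow_mult nat_pow_pow)
    then have "x [^] i \<otimes> y [^] j = x [^] i \<otimes> x [^] (c * (j div n)) \<otimes> y [^] (j mod n)"
      using xy by (simp add: yn nat_pow_pow m_assoc)
    also have "\<dots> = x [^] ((i + c * (j div n)) mod a) \<otimes> y [^] (j mod n)"
      using x pow_x[of "i + c * (j div n)"] by (simp add: nat_pow_mult)
    finally show ?thesis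
      using a n by (intro image_eqI[of _ _ "((i + c * (j div n)) mod a, j mod n)"]) auto
  qed
  have inv_pow: "inv z = z [^] (k - 1)" if "z \<in> carrier G" "z [^] k = \<one>" "0 < k" for z and k :: nat
    using that by (intro inv_equality) (simp_all flip: nat_pow_Suc)
  have yna: "y [^] (n * a) = \<one>"
  proof -
    have "y [^] (n * a) = (y [^] n) [^] a" using y by (simp add: nat_pow_pow)
    also have "\<dots> = (x [^] a) [^] c" using x by (simp add: yn nat_pow_pow mult.commute)
    finally show ?thesis by (simp add: xa)
  qed
  (* Both generators have finite order, so their inverses are powers with exponents in nat. *)
  have "\<exists>(i :: nat) (j :: nat). z = x [^] i \<otimes> y [^] j" if "z \<in> generate G {x, y}" for z
    using that
  proof induction
    case one
    show ?case by (rule exI[of _ "0 :: nat"], rule exI[of _ "0 :: nat"]) simp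
  next
    case (incl h)
    have "x = x [^] (1 :: nat) \<otimes> y [^] (0 :: nat)" "y = x [^] (0 :: nat) \<otimes> y [^] (1 :: nat)"
      using xy by auto
    with incl show ?case by (metis empty_iff insert_iff)
  next
    case (inv h)
    have "inv x = x [^] (a - 1) \<otimes> y [^] (0 :: nat)" "inv y = x [^] (0 :: nat) \<otimes> y [^] (n * a - 1)"
      using inv_pow[OF x xa a] inv_pow[OF y yna] xy a n by auto
    with inv show ?case by (metis empty_iff insert_iff)
  next
    case (eng h1 h2)
    then obtain i j i' j'
      where h: "h1 = x [^] (i :: nat) \<otimes> y [^] (j :: nat)" "h2 = x [^] (i' :: nat) \<otimes> y [^] (j' :: nat)" by blast
    have "h1 \<otimes> h2 = x [^] i \<otimes> (y [^] j \<otimes> x [^] i') \<otimes> y [^] j'"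
      using xy by (simp add: h m_assoc)
    also have "\<dots> = x [^] (i + l ^ j * i') \<otimes> y [^] (j + j')"
      using xy by (simp add: yjxi m_assoc nat_pow_mult[symmetric])
    finally show ?case by (intro exI)
  qed
  then show ?thesis using reduce by (metis (no_types, lifting) subsetI)
qed

end

lemma range_gen: "range f = {f Gen_x, f Gen_y}"
proof -
  have "(UNIV :: gen set) = {Gen_x, Gen_y}" using gen.exhaust by blast
  then show ?thesis by (metis image_insert image_empty)
qed

section \<open>Roots of unity and the Frobenius map of a finite field\<close>

text \<open>If \<open>i u = j v + 1\<close>, then iterating \<open>f\<close> once has the same effect on \<open>x\<close> as iterating it
  \<open>i u\<close> times. It is used for the Frobenius map and for multiplication by a root of unity.\<close>

lemma funpow_coprime_fixed:
  assumes "(f ^^ i) x = x" "(f ^^ j) x = x" "coprime i j"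
  shows "f x = x"
proof (cases "j = 0")
  case True
  then show ?thesis using assms by simp
next
  case False
  have iter: "(f ^^ (k * n)) x = x" if "(f ^^ k) x = x" for k n
    using that by (induction n) (simp_all add: funpow_add)
  show ?thesis
  proof (cases "i = 0")
    case True
    then show ?thesis using assms by simp
  next
    case False
    then obtain u v where "i * u = j * v + 1"
      using bezout_nat[of i j] \<open>coprime i j\<close> by auto
    then have "x = f ((f ^^ (j * v)) x)"
      using iter[OF assms(1), of u] by simp
    then show ?thesis using iter[OF assms(2), of v] by simp
  qed
qed

lemma root_of_unity_order:
  fixes \<omega> :: "'a::monoid_mult"
  assumes "prime m" "\<omega> ^ m = 1" "\<omega> \<noteq> 1"
  shows "\<omega> ^ n = 1 \<longleftrightarrow> m dvd n"
proof
  assume "\<omega> ^ n = 1"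
  show "m dvd n"
  proof (rule ccontr)
    assume "\<not> m dvd n"
    then have "coprime m n" using \<open>prime m\<close> prime_imp_coprime by blast
    have pow: "((*) \<omega> ^^ k) 1 = \<omega> ^ k" for k by (induction k) simp_all
    have "\<omega> * 1 = 1"
      using funpow_coprime_fixed[of m "(*) \<omega>" 1 n] assms(2) \<open>\<omega> ^ n = 1\<close> \<open>coprime m n\<close>
      by (simp add: pow)
    with assms(3) show False by simp
  qed
next
  assume "m dvd n"
  then show "\<omega> ^ n = 1" using assms(2) by (auto simp: power_mult elim!: dvdE)
qed

lemma degree_monom_diff: "degree p < n \<Longrightarrow> degree (monom 1 n - p :: 'a::field poly) = n"
  using degree_add_eq_left[of "- p" "monom 1 n"] by (simp add: degree_monom_eq)

lemma card_power_eq_le: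
  fixes c :: "'a::field"
  assumes "0 < n"
  shows "finite {x. x ^ n = c}" "card {x. x ^ n = c} \<le> n"
proof -
  let ?p = "monom 1 n - [:c:] :: 'a poly"
  have deg: "degree ?p = n"
    using assms by (simp add: degree_monom_diff)
  then have "?p \<noteq> 0" using assms by auto
  moreover have "{x. poly ?p x = 0} = {x. x ^ n = c}" by (simp add: poly_monom)
  ultimately show "finite {x. x ^ n = c}" "card {x. x ^ n = c} \<le> n"
    using poly_roots_finite[of ?p] card_poly_roots_bound[of ?p] deg by simp_all
qed

lemma powers_inj_on:
  fixes u :: "'a::field"
  assumes "0 < n" "\<And>i. u ^ i = 1 \<longleftrightarrow> n dvd i"
  shows "inj_on ((^) u) {..<n}"
proof (rule linorder_inj_onI')
  fix i j assume "i \<in> {..<n}" "j \<in> {..<n}" "i < j"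
  have "u ^ n = 1" using assms(2) by simp
  then have "u \<noteq> 0" using assms(1) by (auto simp: power_0_left)
  have "u ^ j = u ^ i * u ^ (j - i)" using \<open>i < j\<close> by (simp flip: power_add)
  moreover have "u ^ (j - i) \<noteq> 1"
    using assms(2) \<open>i < j\<close> \<open>j \<in> {..<n}\<close> by (auto dest: dvd_imp_le)
  ultimately show "u ^ i \<noteq> u ^ j" using \<open>u \<noteq> 0\<close> by simp
qed

text \<open>The powers of \<open>u\<close> are already \<open>n\<close> different roots of \<open>X\<^sup>n - 1\<close>, which has no more.\<close>

lemma root_of_unity_is_power:
  fixes u x :: "'a::field"
  assumes "0 < n" "\<And>i. u ^ i = 1 \<longleftrightarrow> n dvd i" "x ^ n = 1"
  shows "\<exists>i<n. x = u ^ i"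
proof -
  have "(^) u ` {..<n} = {x :: 'a. x ^ n = 1}"
  proof (rule card_seteq)
    show "(^) u ` {..<n} \<subseteq> {x :: 'a. x ^ n = 1}"
      using assms(2) by (auto simp flip: power_mult)
    show "card {x :: 'a. x ^ n = 1} \<le> card ((^) u ` {..<n})"
      using card_power_eq_le(2)[OF assms(1), of 1] card_image[OF powers_inj_on[OF assms(1,2)]] by simp
  qed (use card_power_eq_le assms(1) in auto)
  then show ?thesis using assms(3) by blast
qed

text \<open>Multiplication by \<open>x\<close> permutes the nonzero elements and so does not change their product.\<close>

lemma finite_field_power_card:
  fixes x :: "'a::{field,finite}"
  assumes "x \<noteq> 0"
  shows "x ^ (card (UNIV :: 'a set) - 1) = 1"
proof -
  let ?U = "UNIV - {0 :: 'a}"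
  have "(\<Prod>y\<in>?U. y) = (\<Prod>y\<in>?U. x * y)"
    by (rule prod.reindex_bij_witness[of _ "\<lambda>y. x * y" "\<lambda>y. y / x"]) (use assms in auto)
  also have "\<dots> = x ^ card ?U * (\<Prod>y\<in>?U. y)" by (simp add: prod.distrib)
  finally have "x ^ card ?U = 1" by simp
  then show ?thesis by simp
qed

locale finite_extension =
  fixes emb :: "'f::{field,finite} \<Rightarrow> 'k::{field,finite}" and \<alpha> :: 'k and q m s :: nat
  assumes embedding: "field_embedding emb"
    and card_F: "card (UNIV :: 'f set) = q"
    and card_K: "card (UNIV :: 'k set) = q ^ m"
    and s_eq: "s = (q ^ m - 1) div (q - 1)"
    and alpha: "- {0} = range (\<lambda>n :: int. \<alpha> powi n)"
    and prime_m: "prime m"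
    and m_dvd: "m dvd q - 1"
begin

lemma emb_simps [simp]:
  "emb 1 = 1" "emb (x + y) = emb x + emb y" "emb (x * y) = emb x * emb y"
  using embedding by (simp_all add: field_embedding_def)

lemma emb_0 [simp]: "emb 0 = 0"
proof -
  have "emb 0 + emb 0 = emb 0" by (simp only: add_0 flip: emb_simps(2))
  then show ?thesis by (metis add_cancel_right_right)
qed

lemma emb_diff [simp]: "emb (x - y) = emb x - emb y"
  using emb_simps(2)[of "x - y" y] by simp

lemma emb_power [simp]: "emb (x ^ n) = emb x ^ n"
  by (induction n) simp_all

lemma emb_of_nat [simp]: "emb (of_nat n) = of_nat n"
  by (induction n) simp_all

lemma emb_eq_0_iff [simp]: "emb x = 0 \<longleftrightarrow> x = 0"
proof
  assume "emb x = 0"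
  show "x = 0"
  proof (rule ccontr)
    assume "x \<noteq> 0"
    then have "emb (x * inverse x) = 1" by simp
    then show False by (simp only: emb_simps \<open>emb x = 0\<close>) simp
  qed
qed simp

lemma inj_emb: "inj emb"
  by (rule injI) (metis emb_diff emb_eq_0_iff right_minus_eq)

lemma q_ge_2: "2 \<le> q"
proof -
  have "card {0, 1 :: 'f} \<le> q" unfolding card_F[symmetric] by (rule card_mono) auto
  then show ?thesis by simp
qed

lemma power_card_F: "c ^ q = c" for c :: 'f
  using finite_field_power_card[of c] q_ge_2
  by (cases "c = 0") (simp_all add: card_F power_eq_if[of c q])

lemma m_ge_2: "2 \<le> m" using prime_m by (rule prime_ge_2_nat)

lemma s_sum: "s = (\<Sum>i<m. q ^ i)" and order_K: "q ^ m - 1 = s * (q - 1)" and s_pos: "0 < s"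
proof -
  have eq: "q ^ m - 1 = (\<Sum>i<m. q ^ i) * (q - 1)"
  proof -
    have "int (q ^ m - 1) = int ((\<Sum>i<m. q ^ i) * (q - 1))"
      using q_ge_2 one_diff_power_eq[of "int q" m] by (simp add: of_nat_diff algebra_simps)
    then show ?thesis by (simp only: of_nat_eq_iff)
  qed
  then show s: "s = (\<Sum>i<m. q ^ i)" using q_ge_2 by (simp add: s_eq)
  with eq show "q ^ m - 1 = s * (q - 1)" by simp
  show "0 < s" using q_ge_2 m_ge_2 by (subst s) (auto intro!: sum_pos simp: lessThan_empty_iff)
qed

lemma order_K_pos: "0 < q ^ m - 1"
  unfolding order_K using s_pos q_ge_2 by simp

text \<open>Writing \<open>q = 1 + m t\<close> and expanding each power \<open>q\<^sup>i\<close> modulo \<open>m\<^sup>2\<close> determines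
  \<open>s = 1 + q + \<dots> + q\<^sup>m\<^sup>-\<^sup>1\<close> modulo \<open>m\<^sup>2\<close>. The sum \<open>0 + \<dots> + (m - 1)\<close> is a multiple of \<open>m\<close> precisely
  when \<open>m\<close> is odd; this is where the case \<open>m = 2\<close> separates from the others.\<close>

lemma s_mod_m_squared:
  obtains t c where "s = m + m * t * (\<Sum>i<m. i) + m ^ 2 * c"
proof -
  obtain t where "q - 1 = m * t" using m_dvd by blast
  then have q: "q = 1 + m * t" using q_ge_2 by simp
  have power: "\<exists>c. q ^ i = 1 + i * m * t + m ^ 2 * c" for i
  proof (induction i)
    case (Suc i)
    then obtain c where "q ^ i = 1 + i * m * t + m ^ 2 * c" by blast
    then have "q ^ Suc i = 1 + Suc i * m * t + m ^ 2 * (c + i * t ^ 2 + m * t * c)"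
      by (simp add: q algebra_simps power2_eq_square)
    then show ?case by blast
  qed simp
  have "\<exists>c. (\<Sum>i<n. q ^ i) = n + m * t * (\<Sum>i<n. i) + m ^ 2 * c" for n
  proof (induction n)
    case (Suc n)
    then obtain c where c: "(\<Sum>i<n. q ^ i) = n + m * t * (\<Sum>i<n. i) + m ^ 2 * c" by blast
    obtain c' where "q ^ n = 1 + n * m * t + m ^ 2 * c'" using power by blast
    with c have "(\<Sum>i<Suc n. q ^ i) = Suc n + m * t * (\<Sum>i<Suc n. i) + m ^ 2 * (c + c')"
      by (simp add: algebra_simps)
    then show ?case by blast
  qed simp
  then show ?thesis using that s_sum by metis
qed

lemma m_dvd_s: "m dvd s"
proof -
  obtain t c where "s = m + m * t * (\<Sum>i<m. i) + m ^ 2 * c" by (rule s_mod_m_squared)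
  then show ?thesis by (simp add: power2_eq_square)
qed

lemma not_m_squared_dvd_s:
  assumes "m \<noteq> 2"
  shows "\<not> m ^ 2 dvd s"
proof
  obtain t c where s: "s = m + m * t * (\<Sum>i<m. i) + m ^ 2 * c" by (rule s_mod_m_squared)
  have "odd m" using assms prime_m primes_dvd_imp_eq two_is_prime_nat by blast
  then obtain h where h: "m = 2 * h + 1" by (rule oddE)
  have "(\<Sum>i<Suc n. i) * 2 = n * Suc n" for n by (induction n) simp_all
  from this[of "2 * h"] have "(\<Sum>i<m. i) = m * h" by (simp add: h)
  with s have "s = m + m ^ 2 * (t * h + c)" by (simp add: algebra_simps power2_eq_square)
  moreover assume "m ^ 2 dvd s"
  ultimately have "m * m dvd m * 1" by (simp add: power2_eq_square dvd_add_left_iff)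
  then show False using m_ge_2 by simp
qed

subsection \<open>The primitive element\<close>

lemma alpha_nonzero: "\<alpha> \<noteq> 0"
proof
  assume "\<alpha> = 0"
  then have "\<alpha> powi 1 \<notin> - {0}" by simp
  then show False unfolding alpha by blast
qed

lemma power_card_K: "x \<noteq> 0 \<Longrightarrow> x ^ (q ^ m - 1) = 1" for x :: 'k
  using finite_field_power_card[of x] by (simp add: card_K)

lemma alpha_power_exists:
  assumes "x \<noteq> 0"
  obtains n where "x = \<alpha> ^ n"
proof -
  from assms have "x \<in> range (\<lambda>n :: int. \<alpha> powi n)" using alpha by blast
  then obtain i :: int where x: "x = \<alpha> powi i" by blast
  show ?thesis
  proof (cases "0 \<le> i")
    case True
    then show ?thesis using that[of "nat i"] x by (simp add: power_int_def)
  next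
    case False
    let ?k = "nat (- i)"
    have "x * \<alpha> ^ ?k = 1"
      using False alpha_nonzero by (simp add: x power_int_def flip: power_mult_distrib)
    moreover have "\<alpha> ^ (?k * (q ^ m - 1 - 1)) * \<alpha> ^ ?k = 1"
    proof -
      have "?k * (q ^ m - 1 - 1) + ?k = (q ^ m - 1) * ?k"
        using order_K_pos by (cases "q ^ m - 1") (simp_all add: algebra_simps)
      then show ?thesis
        by (metis power_add power_mult power_card_K alpha_nonzero power_one)
    qed
    ultimately have "x = \<alpha> ^ (?k * (q ^ m - 1 - 1))"
      using alpha_nonzero by (metis mult_right_cancel power_not_zero)
    then show ?thesis by (rule that)
  qed
qed

lemma alpha_order: "\<alpha> ^ n = 1 \<longleftrightarrow> q ^ m - 1 dvd n"
proof
  let ?N = "q ^ m - 1"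
  have "0 < ?N" by (rule order_K_pos)
  have mod_N: "\<alpha> ^ n = \<alpha> ^ (n mod ?N)" for n
  proof -
    have "\<alpha> ^ n = \<alpha> ^ (?N * (n div ?N) + n mod ?N)" by simp
    also have "\<dots> = \<alpha> ^ (n mod ?N)"
      by (simp only: power_add power_mult power_card_K[OF alpha_nonzero] power_one mult_1_left)
    finally show ?thesis .
  qed
  have "(^) \<alpha> ` {..<?N} = - {0}"
  proof
    show "- {0} \<subseteq> (^) \<alpha> ` {..<?N}"
    proof
      fix x :: 'k assume "x \<in> - {0}"
      then obtain n where "x = \<alpha> ^ n" using alpha_power_exists by blast
      then show "x \<in> (^) \<alpha> ` {..<?N}"
        using mod_N[of n] \<open>0 < ?N\<close> by (intro image_eqI[of _ _ "n mod ?N"]) auto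
    qed
  qed (use alpha_nonzero in auto)
  then have "inj_on ((^) \<alpha>) {..<?N}"
    by (intro eq_card_imp_inj_on) (simp_all add: card_K Compl_eq_Diff_UNIV)
  moreover assume "\<alpha> ^ n = 1"
  ultimately have "n mod ?N = 0"
    using mod_N[of n] \<open>0 < ?N\<close> by (metis inj_onD lessThan_iff mod_less_divisor power_0)
  then show "?N dvd n" by auto
next
  assume "q ^ m - 1 dvd n"
  then show "\<alpha> ^ n = 1" using power_card_K[OF alpha_nonzero] by (auto simp: power_mult elim!: dvdE)
qed

text \<open>The norm \<open>k \<mapsto> k\<^sup>s\<close> maps onto \<open>F\<^sup>\<times>\<close>, the set of solutions of \<open>x\<^sup>q\<^sup>-\<^sup>1 = 1\<close>: if
  \<open>(\<alpha>\<^sup>n)\<^sup>q\<^sup>-\<^sup>1 = 1\<close>, then the order \<open>s (q - 1)\<close> of \<open>\<alpha>\<close> divides \<open>n (q - 1)\<close>.\<close>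

lemma root_exists:
  assumes "(x :: 'k) ^ (q - 1) = 1"
  obtains k where "k ^ s = x"
proof -
  have "x \<noteq> 0" using assms q_ge_2 by (auto simp: power_0_left split: if_splits)
  then obtain n where x: "x = \<alpha> ^ n" by (rule alpha_power_exists)
  with assms have "s * (q - 1) dvd n * (q - 1)"
    by (metis alpha_order power_mult order_K)
  then obtain t where "n = s * t" using q_ge_2 by (auto elim!: dvdE)
  then show ?thesis using that[of "\<alpha> ^ t"] by (simp add: x mult.commute flip: power_mult)
qed

subsection \<open>The Frobenius map\<close>

text \<open>The polynomial \<open>(X + 1)\<^sup>q - X\<^sup>q - 1\<close> has degree less than \<open>q\<close>, and it vanishes on all \<open>q\<close>
  elements of \<open>F\<close> because \<open>y\<^sup>q = y\<close> there. So its coefficients are zero in \<open>F\<close> and hence in \<open>K\<close>.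
  This is what makes the Frobenius map additive.\<close>

lemma binomial_eq_0:
  assumes "0 < i" "i < q"
  shows "(of_nat (q choose i) :: 'k) = 0"
proof -
  let ?p = "\<Sum>i\<in>{1..<q}. monom (of_nat (q choose i)) i :: 'f poly"
  have "?p = 0"
  proof (rule poly_eqI_degree[of UNIV])
    fix x :: 'f
    have fixed: "y ^ q = y" for y :: 'f by (rule power_card_F)
    have "(x + 1) ^ q = (\<Sum>k\<le>q. of_nat (q choose k) * x ^ k)"
      by (simp add: binomial_ring)
    also have "{..q} = insert 0 (insert q {1..<q})" using q_ge_2 by auto
    also have "(\<Sum>k\<in>\<dots>. of_nat (q choose k) * x ^ k) =
      1 + (x ^ q + (\<Sum>k\<in>{1..<q}. of_nat (q choose k) * x ^ k))"
      using q_ge_2 by simp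
    finally have "(\<Sum>k\<in>{1..<q}. of_nat (q choose k) * x ^ k) = 0" by (simp add: fixed)
    then show "poly ?p x = poly 0 x" by (simp add: poly_sum poly_monom)
  next
    have "degree ?p \<le> q - 1"
      by (rule degree_sum_le) (auto intro: le_trans[OF degree_monom_le])
    then show "degree ?p < card (UNIV :: 'f set)" using q_ge_2 by (simp add: card_F)
  qed (use q_ge_2 card_F in simp_all)
  then have "coeff ?p i = 0" by simp
  then have "(of_nat (q choose i) :: 'f) = 0"
    using assms by (simp add: coeff_sum)
  then show ?thesis by (metis emb_0 emb_of_nat)
qed

lemma frobenius_add: "(x + y) ^ q = x ^ q + y ^ q" for x y :: 'k
proof -
  have "(x + y) ^ q = (\<Sum>k\<le>q. of_nat (q choose k) * x ^ k * y ^ (q - k))"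
    by (rule binomial_ring)
  also have "\<dots> = (\<Sum>k\<in>{0, q}. of_nat (q choose k) * x ^ k * y ^ (q - k))"
    by (rule sum.mono_neutral_right) (auto simp: binomial_eq_0)
  also have "\<dots> = x ^ q + y ^ q" using q_ge_2 by simp
  finally show ?thesis .
qed

lemma frobenius_power_add: "(x + y) ^ (q ^ j) = x ^ (q ^ j) + y ^ (q ^ j)" for x y :: 'k
proof (induction j)
  case (Suc j)
  have "q ^ Suc j = q ^ j * q" by simp
  then show ?case by (simp only: power_mult Suc frobenius_add)
qed simp

lemma frobenius_power_diff: "(x - y) ^ (q ^ j) = x ^ (q ^ j) - y ^ (q ^ j)" for x y :: 'k
  using frobenius_power_add[of "x - y" y j] by (simp add: algebra_simps)

lemma frobenius_iterate: "((\<lambda>x :: 'k. x ^ q) ^^ j) x = x ^ (q ^ j)"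
  by (induction j) (simp_all add: mult.commute flip: power_mult)

lemma power_q_m [simp]: "x ^ (q ^ m) = x" for x :: 'k
proof (cases "x = 0")
  case False
  then show ?thesis using power_card_K[of x] q_ge_2 by (simp add: power_eq_if[of x "q ^ m"])
qed (use q_ge_2 in simp)

text \<open>All \<open>q\<close> elements of \<open>F\<close> are roots of \<open>X\<^sup>q - X\<close>, which leaves no room for others.\<close>

lemma range_emb: "x \<in> range emb \<longleftrightarrow> x ^ q = x"
proof -
  have "range emb = {x :: 'k. x ^ q = x}"
  proof (rule card_seteq)
    show "range emb \<subseteq> {x :: 'k. x ^ q = x}"
    proof clarify
      fix c :: 'f
      show "emb c ^ q = emb c" by (metis emb_power power_card_F)
    qed
    let ?p = "monom 1 q - monom 1 1 :: 'k poly"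
    have deg: "degree ?p = q"
      using q_ge_2 by (simp add: degree_monom_diff degree_monom_eq)
    then have "?p \<noteq> 0" using q_ge_2 by auto
    moreover have "{x. poly ?p x = 0} = {x. x ^ q = x}" by (simp add: poly_monom)
    ultimately have "card {x :: 'k. x ^ q = x} \<le> q"
      using card_poly_roots_bound[of ?p] deg by simp
    then show "card {x :: 'k. x ^ q = x} \<le> card (range emb)"
      by (simp add: card_image inj_emb card_F)
  qed simp
  then show ?thesis by blast
qed

lemma frobenius_fixes_emb [simp]: "emb c ^ (q ^ j) = emb c"
proof -
  have "(\<lambda>x. x ^ q) (emb c) = emb c" using range_emb by blast
  then have "((\<lambda>x. x ^ q) ^^ j) (emb c) = emb c" by (induction j) simp_all
  then show ?thesis by (simp add: frobenius_iterate)
qed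

lemma range_emb_iff_power: "x \<noteq> 0 \<Longrightarrow> x \<in> range emb \<longleftrightarrow> x ^ (q - 1) = 1"
proof -
  assume "x \<noteq> 0"
  have "x ^ q = x * x ^ (q - 1)" using q_ge_2 by (simp add: power_eq_if[of x q])
  then show ?thesis using \<open>x \<noteq> 0\<close> by (auto simp: range_emb)
qed

text \<open>The Frobenius map has order \<open>m\<close>, so its \<open>j\<close>-th power has no more fixed points than the map
  itself when \<open>j\<close> is prime to \<open>m\<close>.\<close>

lemma frobenius_fixed_coprime:
  assumes "(x :: 'k) ^ (q ^ j) = x" "coprime j m"
  shows "x \<in> range emb"
  using funpow_coprime_fixed[of j "\<lambda>x. x ^ q" x m] assms
  by (simp add: frobenius_iterate range_emb)

lemma frobenius_mod: "x ^ (q ^ (j mod m)) = x ^ (q ^ j)" for x :: 'k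
proof -
  have "((\<lambda>x :: 'k. x ^ q) ^^ m) x = x" for x by (simp add: frobenius_iterate)
  from funpow_mod_eq[OF this] show ?thesis by (simp add: frobenius_iterate)
qed

subsection \<open>Generators of the form \<open>d\<^sup>m \<in> F\<close>\<close>

lemma is_subfield_frobenius_fixed:
  assumes "\<And>x y. \<tau> (x + y) = \<tau> x + \<tau> y" "\<And>x y. \<tau> (x * y) = \<tau> x * \<tau> y" "\<tau> 1 = 1"
  shows "is_subfield {x :: 'k. \<tau> x = x ^ (q ^ j)}"
proof -
  have 0: "\<tau> 0 = 0" using assms(1)[of 0 0] by (metis add_0 add_cancel_right_right)
  have diff: "\<tau> (x - y) = \<tau> x - \<tau> y" for x y using assms(1)[of "x - y" y] by simp
  have inv: "\<tau> (inverse x) = inverse (\<tau> x)" for x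
    using assms(2)[of x "inverse x"] assms(3) 0 by (cases "x = 0") (auto simp: inverse_unique)
  show ?thesis
    by (auto simp: is_subfield_def assms(2,3) diff inv frobenius_power_diff power_mult_distrib power_inverse)
qed

text \<open>The elements on which two field homomorphisms agree form a subfield, so a homomorphism over
  \<open>F\<close> is determined by its value at a generator.\<close>

lemma adjoin_frobenius:
  assumes "adjoin emb d = UNIV"
    and "\<And>x y. \<tau> (x + y) = \<tau> x + \<tau> y" "\<And>x y. \<tau> (x * y) = \<tau> x * \<tau> y" "\<And>c. \<tau> (emb c) = emb c"
    and "\<tau> d = d ^ (q ^ j)"
  shows "\<tau> x = x ^ (q ^ j)"
proof -
  let ?L = "{x. \<tau> x = x ^ (q ^ j)}"
  have "\<tau> 1 = 1" using assms(4)[of 1] by simp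
  then have "is_subfield ?L" using assms(2,3) by (intro is_subfield_frobenius_fixed)
  moreover have "range emb \<subseteq> ?L" using assms(4) by auto
  ultimately have "adjoin emb d \<subseteq> ?L" using assms(5) by (auto simp: adjoin_def)
  then show ?thesis using assms(1) by auto
qed

lemma poly_map_emb_simps:
  "poly (map_poly emb (pCons c p)) x = emb c + x * poly (map_poly emb p) x"
  "poly (map_poly emb (p + p')) x = poly (map_poly emb p) x + poly (map_poly emb p') x"
  "poly (map_poly emb (p * p')) x = poly (map_poly emb p) x * poly (map_poly emb p') x"
proof -
  show pCons: "poly (map_poly emb (pCons c p)) x = emb c + x * poly (map_poly emb p) x" for c p
    by (simp add: map_poly_pCons)
  have add: "map_poly emb (p + p') = map_poly emb p + map_poly emb p'" for p p'
    by (rule poly_eqI) (simp add: coeff_map_poly)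
  then show "poly (map_poly emb (p + p')) x = poly (map_poly emb p) x + poly (map_poly emb p') x"
    by simp
  have "map_poly emb (smult c p) = smult (emb c) (map_poly emb p)" for c p
    by (rule poly_eqI) (simp add: coeff_map_poly)
  then show "poly (map_poly emb (p * p')) x = poly (map_poly emb p) x * poly (map_poly emb p') x"
    by (induction p) (simp_all add: add map_poly_pCons algebra_simps)
qed

lemma poly_map_emb_frobenius:
  "poly (map_poly emb p) (x ^ (q ^ j)) = (poly (map_poly emb p) x) ^ (q ^ j)"
proof (induction p)
  case (pCons c p)
  then show ?case
    by (simp add: poly_map_emb_simps(1) pCons frobenius_power_add power_mult_distrib)
qed (use q_ge_2 in simp)

end

context finite_extension
begin

lemma coprime_less_m: "0 < i \<Longrightarrow> i < m \<Longrightarrow> coprime i m"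
  by (metis coprime_commute nat_dvd_not_less prime_imp_coprime prime_m)

text \<open>An element \<open>d\<close> with \<open>d\<^sup>m \<in> F\<close> is an eigenvector of the Frobenius map, for the eigenvalue
  \<open>\<omega> = d\<^sup>q\<^sup>-\<^sup>1\<close>. This \<open>\<omega>\<close> is an \<open>m\<close>-th root of unity, so it lies in \<open>F\<close> because \<open>m\<close> divides
  \<open>q - 1\<close>, and it is not \<open>1\<close> unless \<open>d \<in> F\<close>.\<close>

lemma frobenius_eigenvalue:
  assumes "d ^ m \<in> range emb" "d \<notin> range emb"
  obtains \<omega> where "\<omega> ^ m = 1" "\<omega> \<noteq> 1" "\<omega> ^ q = \<omega>" "\<And>j. d ^ (q ^ j) = \<omega> ^ j * d"
proof -
  define \<omega> where "\<omega> = d ^ (q - 1)"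
  have d: "d \<noteq> 0" using assms(2) emb_0 by (metis rangeI)
  have "(d ^ m) ^ (q - 1) = 1" using range_emb_iff_power[of "d ^ m"] assms(1) d by simp
  then have w: "\<omega> ^ m = 1" by (simp add: \<omega>_def mult.commute flip: power_mult)
  have w1: "\<omega> \<noteq> 1" using range_emb_iff_power[OF d] assms(2) by (simp add: \<omega>_def)
  have "\<omega> ^ (q - 1) = 1" using w m_dvd by (auto simp: power_mult simp del: One_nat_def elim!: dvdE)
  then have "\<omega> ^ Suc (q - 1) = \<omega>" by (simp only: power_Suc mult_1_right)
  then have wq: "\<omega> ^ q = \<omega>" using q_ge_2 by simp
  have dq: "d ^ q = \<omega> * d" using q_ge_2 by (simp add: \<omega>_def power_eq_if[of d q])
  have "d ^ (q ^ j) = \<omega> ^ j * d" for j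
  proof (induction j)
    case (Suc j)
    have "d ^ (q ^ Suc j) = (d ^ (q ^ j)) ^ q" by (simp add: mult.commute flip: power_mult)
    also have "\<dots> = (\<omega> ^ q) ^ j * d ^ q"
      by (simp add: Suc power_mult_distrib mult.commute flip: power_mult)
    also have "\<dots> = \<omega> ^ Suc j * d" by (simp add: wq dq)
    finally show ?case .
  qed simp
  with w w1 wq show ?thesis by (rule that)
qed

text \<open>With \<open>d\<close> its \<open>m\<close> different conjugates \<open>\<omega>\<^sup>j d\<close> are roots, too many for the degree.\<close>

lemma poly_vanishing_at_generator:
  assumes "d ^ m \<in> range emb" "d \<notin> range emb"
    and "degree p < m" "poly (map_poly emb p) d = 0"
  shows "p = 0"
proof -
  obtain \<omega> where w: "\<omega> ^ m = 1" "\<omega> \<noteq> 1" "\<omega> ^ q = \<omega>" "\<And>j. d ^ (q ^ j) = \<omega> ^ j * d"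
    using frobenius_eigenvalue[OF assms(1,2)] by blast
  have d: "d \<noteq> 0" using assms(2) emb_0 by (metis rangeI)
  let ?A = "(\<lambda>j. \<omega> ^ j * d) ` {..<m}"
  have "inj_on ((^) \<omega>) {..<m}"
    using root_of_unity_order[OF prime_m w(1,2)] m_ge_2 by (intro powers_inj_on) auto
  then have "inj_on (\<lambda>j. \<omega> ^ j * d) {..<m}" using d by (simp add: inj_on_def)
  then have card: "card ?A = m" by (simp add: card_image)
  have deg: "degree (map_poly emb p) = degree p"
    by (rule degree_map_poly) simp
  have "map_poly emb p = 0"
  proof (rule poly_eqI_degree[of ?A])
    fix x assume "x \<in> ?A"
    then obtain j where "x = d ^ (q ^ j)" using w(4) by auto
    then show "poly (map_poly emb p) x = poly 0 x"
      using q_ge_2 by (simp add: poly_map_emb_frobenius assms(4))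
  qed (use assms(3) deg card m_ge_2 in simp_all)
  then show ?thesis by (metis deg degree_0 emb_eq_0_iff coeff_map_poly coeff_0 emb_0 poly_eqI)
qed

text \<open>In a factorization of \<open>X\<^sup>m - e\<close> one factor vanishes at \<open>d\<close> and hence has full degree. A
  subfield that contains \<open>F\<close> and \<open>d\<close> contains the \<open>q\<^sup>m\<close> different values at \<open>d\<close> of the polynomials
  of degree less than \<open>m\<close>, so it is all of \<open>K\<close>.\<close>

lemma pure_generatorI:
  assumes "d ^ m = emb e" "d \<notin> range emb"
  shows "pure_generator emb m e d"
proof -
  have "d ^ m \<in> range emb" using assms(1) by simp
  note vanish = poly_vanishing_at_generator[OF this assms(2)]
  have d: "d \<noteq> 0" using assms(2) emb_0 by (metis rangeI)
  let ?P = "monom 1 m - [:e:] :: 'f poly"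
  have deg: "degree ?P = m" using m_ge_2 by (simp add: degree_monom_diff)
  then have "?P \<noteq> 0" using m_ge_2 by auto
  have map_P: "map_poly emb ?P = monom 1 m - [:emb e:]"
    by (rule poly_eqI) (simp add: coeff_map_poly coeff_pCons split: nat.split)
  then have root: "poly (map_poly emb ?P) d = 0" by (simp add: poly_monom assms(1))
  have irred: "irreducible ?P"
  proof (rule irreducibleI)
    show "\<not> is_unit ?P" using is_unit_iff_degree[OF \<open>?P \<noteq> 0\<close>] deg m_ge_2 by simp
    fix g h assume gh: "?P = g * h"
    then have nz: "g \<noteq> 0" "h \<noteq> 0" using \<open>?P \<noteq> 0\<close> by auto
    then have deg_gh: "degree g + degree h = m" using gh deg by (simp add: degree_mult_eq)
    have "poly (map_poly emb g) d = 0 \<or> poly (map_poly emb h) d = 0"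
      using root gh by (simp add: poly_map_emb_simps(3))
    then have "m \<le> degree g \<or> m \<le> degree h" using vanish nz by (meson not_le)
    then have "degree h = 0 \<or> degree g = 0" using deg_gh by auto
    then show "is_unit g \<or> is_unit h" using nz by (auto simp: is_unit_iff_degree)
  qed fact
  have "L = UNIV" if L: "is_subfield L" "range emb \<subseteq> L" "d \<in> L" for L
  proof -
    have one: "1 \<in> L" and diff: "\<And>x y. x \<in> L \<Longrightarrow> y \<in> L \<Longrightarrow> x - y \<in> L"
      and mult: "\<And>x y. x \<in> L \<Longrightarrow> y \<in> L \<Longrightarrow> x * y \<in> L"
      using L(1) by (auto simp: is_subfield_def)
    have zero: "0 \<in> L" using diff[OF one one] by simp
    have add: "x + y \<in> L" if "x \<in> L" "y \<in> L" for x y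
      using diff[OF that(1) diff[OF zero that(2)]] by simp
    let ?p = "\<lambda>c. \<Sum>i<m. monom (c i) i :: 'f poly"
    let ?ev = "\<lambda>c. poly (map_poly emb (?p c)) d"
    have coeff_p: "coeff (?p c) i = (if i < m then c i else 0)" for c i
      by (simp add: coeff_sum)
    have "inj_on ?ev ({..<m} \<rightarrow>\<^sub>E UNIV)"
    proof (rule inj_onI)
      fix c c' assume c: "c \<in> {..<m} \<rightarrow>\<^sub>E UNIV" "c' \<in> {..<m} \<rightarrow>\<^sub>E UNIV" and eq: "?ev c = ?ev c'"
      have "?p c - ?p c' = 0"
      proof (rule vanish)
        show "degree (?p c - ?p c') < m"
          using m_ge_2 by (intro degree_lessI) (auto simp: coeff_p)
        show "poly (map_poly emb (?p c - ?p c')) d = 0"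
          using eq poly_map_emb_simps(2)[of "?p c - ?p c'" "?p c'" d] by simp
      qed
      then have eq: "?p c = ?p c'" by (simp only: right_minus_eq)
      have "c i = c' i" if "i < m" for i
        using arg_cong[OF eq, of "\<lambda>p. coeff p i"] that by (simp only: coeff_p if_True)
      then show "c = c'" using c by (intro PiE_ext[OF c]) auto
    qed
    moreover have "poly (map_poly emb p) d \<in> L" for p
      by (induction p) (use L(2,3) zero in \<open>auto simp: poly_map_emb_simps(1) intro!: add mult\<close>)
    ultimately have "card (({..<m} \<rightarrow>\<^sub>E UNIV) :: (nat \<Rightarrow> 'f) set) \<le> card L"
      by (intro card_inj_on_le[of ?ev]) auto
    then have "card (UNIV :: 'k set) \<le> card L" by (simp add: card_PiE card_F card_K)
    then show "L = UNIV" by (intro card_seteq) auto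
  qed
  then have "adjoin emb d = UNIV" by (auto simp: adjoin_def)
  moreover have "e \<noteq> 0" using assms(1) d by auto
  ultimately show ?thesis using irred root by (simp add: pure_generator_def)
qed

text \<open>Since \<open>m\<close> divides \<open>s\<close>, the power \<open>d = \<alpha>\<^sup>s\<^sup>/\<^sup>m\<close> makes sense, and \<open>d\<^sup>m\<close> is the norm of \<open>\<alpha>\<close>.\<close>

lemma pure_generator_exists: "\<exists>e d. pure_generator emb m e d"
proof -
  let ?d = "\<alpha> ^ (s div m)"
  have "m > 0" using m_ge_2 by simp
  have "?d ^ m = \<alpha> ^ s" using m_dvd_s by (simp flip: power_mult)
  moreover have "\<alpha> ^ s \<in> range emb"
  proof -
    have "(\<alpha> ^ s) ^ (q - 1) = 1"
      using power_card_K[OF alpha_nonzero] by (simp only: order_K power_mult)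
    then show ?thesis using range_emb_iff_power alpha_nonzero by simp
  qed
  ultimately obtain e where e: "?d ^ m = emb e" by auto
  have "?d \<notin> range emb"
  proof
    assume "?d \<in> range emb"
    then have "s * (q - 1) dvd s div m * (q - 1)"
      using range_emb_iff_power[of ?d] alpha_nonzero by (metis alpha_order order_K power_mult power_not_zero)
    then have "s dvd s div m" using q_ge_2 by simp
    moreover have "s div m > 0" using m_dvd_s s_pos by (auto elim!: dvdE)
    ultimately have "s \<le> s div m" using dvd_imp_le by blast
    moreover have "s div m < s" using m_ge_2 s_pos by simp
    ultimately show False by simp
  qed
  with e show ?thesis using pure_generatorI by blast
qed

lemma pure_generatorD:
  assumes "pure_generator emb m e d"
  shows "d ^ m = emb e" "d \<notin> range emb" "adjoin emb d = UNIV"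
proof -
  have map_P: "map_poly emb (monom 1 m - [:e:]) = monom 1 m - [:emb e:]"
    by (rule poly_eqI) (simp add: coeff_map_poly coeff_pCons split: nat.split)
  show "d ^ m = emb e" using assms by (simp add: pure_generator_def map_P poly_monom)
  show adj: "adjoin emb d = UNIV" using assms by (simp add: pure_generator_def)
  show "d \<notin> range emb"
  proof
    assume "d \<in> range emb"
    then have fixed: "id d = d ^ (q ^ 1)" by (simp add: range_emb)
    have "id x = x ^ (q ^ 1)" for x :: 'k
      by (rule adjoin_frobenius[OF adj]) (use fixed in auto)
    then have "range emb = UNIV" by (auto simp: range_emb set_eq_iff)
    then have "q = q ^ m" by (metis card_F card_K card_image inj_emb)
    then show False using q_ge_2 m_ge_2 power_inject_exp[of q 1 m] by simp
  qed
qed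

subsection \<open>The Galois group\<close>

lemma frobenius_power_in_galois_group: "(\<lambda>x. x ^ (q ^ j)) \<in> carrier (galois_group emb)"
proof -
  have "inj (\<lambda>x :: 'k. x ^ (q ^ j))"
  proof (rule injI)
    fix x y :: 'k assume "x ^ (q ^ j) = y ^ (q ^ j)"
    then have "(x - y) ^ (q ^ j) = 0" by (simp add: frobenius_power_diff)
    then show "x = y" by simp
  qed
  then have "bij (\<lambda>x :: 'k. x ^ (q ^ j))" using finite_UNIV_inj_surj[of "\<lambda>x :: 'k. x ^ (q ^ j)"] by (simp add: bij_def)
  then show ?thesis
    by (simp add: galois_group_def Bij_def frobenius_power_add power_mult_distrib)
qed

text \<open>An automorphism over \<open>F\<close> multiplies a generator \<open>d\<close> with \<open>d\<^sup>m \<in> F\<close> by an \<open>m\<close>-th root of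
  unity, as some power of the Frobenius map does; being equal at \<open>d\<close>, the two are equal.\<close>

lemma galois_group_frobenius_power:
  assumes "\<tau> \<in> carrier (galois_group emb)"
  obtains j where "j < m" "\<tau> = (\<lambda>x. x ^ (q ^ j))"
proof -
  have hom: "\<And>x y. \<tau> (x + y) = \<tau> x + \<tau> y" "\<And>x y. \<tau> (x * y) = \<tau> x * \<tau> y" "\<And>c. \<tau> (emb c) = emb c"
    using assms by (simp_all add: galois_group_def)
  obtain e d where gen: "pure_generator emb m e d" using pure_generator_exists by blast
  note d = pure_generatorD[OF gen]
  have "d \<noteq> 0" using d(2) emb_0 by (metis rangeI)
  have "d ^ m \<in> range emb" using d(1) by simp
  then obtain \<omega> where w: "\<omega> ^ m = 1" "\<omega> \<noteq> 1" "\<And>j. d ^ (q ^ j) = \<omega> ^ j * d"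
    using frobenius_eigenvalue d(2) by metis
  have pow: "\<tau> (x ^ n) = \<tau> x ^ n" for x n using hom(2) hom(3)[of 1] by (induction n) simp_all
  have "\<tau> d ^ m = d ^ m" using pow[of d m] d(1) hom(3) by simp
  then have "(\<tau> d / d) ^ m = 1" using \<open>d \<noteq> 0\<close> by (simp only: power_divide) simp
  then obtain j where "j < m" "\<tau> d / d = \<omega> ^ j"
    using root_of_unity_is_power[of m \<omega>] root_of_unity_order[OF prime_m w(1,2)] m_ge_2 by auto
  then have "\<tau> d = d ^ (q ^ j)" using \<open>d \<noteq> 0\<close> by (simp add: w(3) field_simps)
  then have "\<tau> = (\<lambda>x. x ^ (q ^ j))" using adjoin_frobenius[OF d(3) hom] by blast
  with \<open>j < m\<close> show ?thesis by (rule that)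
qed

end

lemma group_galois_group: "group (galois_group emb)"
proof -
  let ?G = "BijGroup UNIV :: ('k::field \<Rightarrow> 'k) monoid"
  interpret B: group ?G by (rule group_BijGroup)
  let ?H = "carrier (galois_group emb)"
  have "subgroup ?H ?G"
  proof (rule B.subgroupI)
    show "?H \<subseteq> carrier ?G" by (auto simp: galois_group_def BijGroup_def)
    have "(\<lambda>x. x) \<in> ?H" using id_Bij[of UNIV] by (simp add: galois_group_def restrict_def)
    then show "?H \<noteq> {}" by blast
  next
    fix \<tau> assume t: "\<tau> \<in> ?H"
    then have tB: "\<tau> \<in> Bij UNIV" by (simp add: galois_group_def)
    have inv: "inv\<^bsub>?G\<^esub> \<tau> = inv_into UNIV \<tau>" using inv_BijGroup[OF tB] by (simp add: restrict_def)
    have "inj \<tau>" using tB by (simp add: Bij_def bij_def)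
    then have "inv_into UNIV \<tau> (emb c) = emb c" for c
      using t by (intro inv_into_f_eq) (auto simp: galois_group_def)
    moreover have "inv_into UNIV \<tau> (x + y) = inv_into UNIV \<tau> x + inv_into UNIV \<tau> y"
      "inv_into UNIV \<tau> (x * y) = inv_into UNIV \<tau> x * inv_into UNIV \<tau> y" for x y
      using t by (auto intro!: Bij_inv_into_lemma[OF _ tB] simp: galois_group_def)
    ultimately show "inv\<^bsub>?G\<^esub> \<tau> \<in> ?H"
      using restrict_inv_into_Bij[OF tB] by (simp add: inv galois_group_def restrict_def)
  next
    fix \<tau> \<rho> assume t: "\<tau> \<in> ?H" "\<rho> \<in> ?H"
    then have "\<tau> \<in> Bij UNIV" "\<rho> \<in> Bij UNIV" by (simp_all add: galois_group_def)
    moreover from this have "compose UNIV \<tau> \<rho> \<in> Bij UNIV" by (rule compose_Bij)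
    ultimately show "\<tau> \<otimes>\<^bsub>?G\<^esub> \<rho> \<in> ?H"
      using t by (simp add: galois_group_def BijGroup_def compose_def)
  qed
  then show ?thesis
    using B.subgroup_imp_group by (simp add: galois_group_def)
qed

locale cyclic_extension = finite_extension emb \<alpha> q m s
  for emb :: "'f::{field,finite} \<Rightarrow> 'k::{field,finite}" and \<alpha> q m s +
  fixes \<sigma> :: "'k \<Rightarrow> 'k"
  assumes sigma_galois: "\<sigma> \<in> carrier (galois_group emb)"
    and sigma_generates: "carrier (galois_group emb) = generate (galois_group emb) {\<sigma>}"
begin

text \<open>The generator \<open>\<sigma>\<close> need not be the Frobenius map itself, but it is a power of it whose
  exponent is prime to \<open>m\<close>.\<close>

lemma sigma_frobenius:
  obtains r where "coprime r m" "\<And>i x. (\<sigma> ^^ i) x = x ^ (q ^ (r * i))"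
proof -
  interpret Gal: group "galois_group emb" by (rule group_galois_group)
  obtain r where r: "r < m" "\<sigma> = (\<lambda>x. x ^ (q ^ r))"
    using galois_group_frobenius_power[OF sigma_galois] by blast
  have "r \<noteq> 0"
  proof
    assume "r = 0"
    then have "\<sigma> = \<one>\<^bsub>galois_group emb\<^esub>"
      using r(2) by (simp add: galois_group_def BijGroup_def restrict_def)
    then have "carrier (galois_group emb) = {\<sigma>}"
      using sigma_generates Gal.generate_one by simp
    then have "(\<lambda>x. x ^ (q ^ 1)) = \<sigma>"
      using frobenius_power_in_galois_group[of 1] by blast
    then have "x ^ q = x" for x :: 'k using r(2) \<open>r = 0\<close> by (auto dest: fun_cong[of _ _ x])
    then have "range emb = UNIV" by (auto simp: range_emb set_eq_iff)
    moreover obtain e d where "pure_generator emb m e d" using pure_generator_exists by blast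
    ultimately show False using pure_generatorD(2) by blast
  qed
  then have "coprime r m"
    using r(1) by (intro coprime_less_m) auto
  moreover have "(\<sigma> ^^ i) x = x ^ (q ^ (r * i))" for i x
    by (induction i) (simp_all add: r(2) power_add mult.commute flip: power_mult)
  ultimately show ?thesis by (rule that)
qed

lemma sigma_pow_fixed:
  assumes "(\<sigma> ^^ i) x = x" "0 < i" "i < m"
  shows "x \<in> range emb"
proof -
  obtain r where r: "coprime r m" "\<And>i x. (\<sigma> ^^ i) x = x ^ (q ^ (r * i))"
    using sigma_frobenius by blast
  have "coprime i m"
    using assms(2,3) by (rule coprime_less_m)
  with r(1) have "coprime (r * i) m" by simp
  then show ?thesis using assms(1) frobenius_fixed_coprime by (simp add: r(2))
qed

text \<open>The conjugates \<open>\<sigma>\<^sup>i(x)\<close> are the powers \<open>x\<close> to the exponents \<open>1, q, \<dots>, q\<^sup>m\<^sup>-\<^sup>1\<close> in some order.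
  So the norm does not depend on the choice of \<open>\<sigma>\<close>.\<close>

lemma norm_eq_power: "(\<Prod>i<m. (\<sigma> ^^ i) x) = x ^ s"
proof -
  obtain r where r: "coprime r m" "\<And>i x. (\<sigma> ^^ i) x = x ^ (q ^ (r * i))"
    using sigma_frobenius by blast
  have inj: "inj_on (\<lambda>i. r * i mod m) {..<m}"
  proof (rule linorder_inj_onI')
    fix i j assume ij: "i \<in> {..<m}" "j \<in> {..<m}" "i < j"
    show "r * i mod m \<noteq> r * j mod m"
    proof
      assume "r * i mod m = r * j mod m"
      then have "m dvd r * (j - i)"
        using ij(3) mod_eq_dvd_iff_nat[of "r * i" "r * j" m] by (simp add: diff_mult_distrib2)
      then have "m dvd j - i" using r(1) by (simp add: coprime_dvd_mult_right_iff coprime_commute)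
      then show False using ij by (auto dest: dvd_imp_le)
    qed
  qed
  have "(\<lambda>i. r * i mod m) ` {..<m} = {..<m}"
    using m_ge_2 by (intro endo_inj_surj inj) auto
  with inj have bij: "bij_betw (\<lambda>i. r * i mod m) {..<m} {..<m}" by (simp add: bij_betw_def)
  have "(\<Prod>i<m. (\<sigma> ^^ i) x) = (\<Prod>i<m. x ^ (q ^ (r * i mod m)))"
    by (simp add: r(2) frobenius_mod)
  also have "\<dots> = (\<Prod>i<m. x ^ (q ^ i))"
    by (rule prod.reindex_bij_betw[OF bij])
  also have "\<dots> = x ^ s" by (simp add: s_sum power_sum)
  finally show ?thesis .
qed

text \<open>Hilbert's Theorem 90 in explicit form: \<open>\<alpha>\<^sup>-\<^sup>1 \<sigma>(\<alpha>)\<close> has order \<open>s\<close>, and so it generates the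
  kernel of the norm \<open>k \<mapsto> k\<^sup>s\<close>. Its \<open>n\<close>-th power is \<open>1\<close> just when \<open>\<alpha>\<^sup>n\<close> is fixed by \<open>\<sigma>\<close>, that is,
  when it lies in \<open>F\<close>.\<close>

lemma hilbert90_generator: "(inverse \<alpha> * \<sigma> \<alpha>) ^ n = 1 \<longleftrightarrow> s dvd n"
proof -
  obtain r where r: "coprime r m" "\<And>i x. (\<sigma> ^^ i) x = x ^ (q ^ (r * i))"
    using sigma_frobenius by blast
  have sigma: "\<sigma> x = x ^ (q ^ r)" for x using r(2)[of 1] by simp
  let ?a = "\<alpha> ^ n"
  have nz: "?a \<noteq> 0" using alpha_nonzero by simp
  have "(inverse \<alpha> * \<sigma> \<alpha>) ^ n = inverse ?a * \<sigma> ?a"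
    by (simp add: sigma power_mult_distrib power_inverse mult.commute flip: power_mult)
  also have "\<dots> = 1 \<longleftrightarrow> \<sigma> ?a = ?a" using nz by (simp add: field_simps)
  also have "\<dots> \<longleftrightarrow> ?a \<in> range emb"
  proof
    assume "\<sigma> ?a = ?a"
    then show "?a \<in> range emb" using sigma_pow_fixed[of 1 ?a] m_ge_2 by simp
  next
    assume "?a \<in> range emb"
    then show "\<sigma> ?a = ?a" using sigma_galois by (auto simp: galois_group_def)
  qed
  also have "\<dots> \<longleftrightarrow> \<alpha> ^ (n * (q - 1)) = 1" using range_emb_iff_power[OF nz] by (simp add: power_mult)
  also have "\<dots> \<longleftrightarrow> s dvd n" using q_ge_2 unfolding alpha_order order_K by simp
  finally show ?thesis .
qed

end

section \<open>The product of a nonassociative cyclic algebra\<close>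

lemma cyclic_index:
  fixes n m k :: nat
  assumes "n < m" "k < m"
  shows "(n + m - k) mod m = (if k \<le> n then n - k else n + m - k)"
proof (cases "k \<le> n")
  case True
  then have "(n + m - k) mod m = (n - k + m) mod m" by simp
  also have "\<dots> = n - k" using assms(1) unfolding mod_add_self2 by simp
  finally show ?thesis using True by simp
qed (use assms in simp)

lemma coeff_const: "coeff [:x:] i = (if i = 0 then x else 0)"
  by (simp add: coeff_pCons split: nat.split)

text \<open>What the description of the automorphisms takes from the field extension: that the parameter
  \<open>a\<close> is moved by the powers \<open>\<sigma>, \<dots>, \<sigma>\<^sup>m\<^sup>-\<^sup>1\<close>, and that \<open>\<sigma>\<close> is central in the Galois group.\<close>

locale nonassociative_cyclic_algebra =
  fixes emb :: "'f::field \<Rightarrow> 'k::field" and \<sigma> :: "'k \<Rightarrow> 'k" and m :: nat and a :: 'k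
  assumes m_ge_2: "2 \<le> m"
    and sigma_galois: "\<sigma> \<in> carrier (galois_group emb)"
    and a_moved: "\<And>i. 0 < i \<Longrightarrow> i < m \<Longrightarrow> (\<sigma> ^^ i) a \<noteq> a"
    and galois_commute: "\<And>\<tau> x. \<tau> \<in> carrier (galois_group emb) \<Longrightarrow> \<tau> (\<sigma> x) = \<sigma> (\<tau> x)"
begin

abbreviation A :: "'k poly set" where "A \<equiv> cyc_carrier m"

abbreviation cmult :: "'k poly \<Rightarrow> 'k poly \<Rightarrow> 'k poly" (infixl "\<star>" 70) where
  "g \<star> h \<equiv> cyc_mult m \<sigma> a g h"

lemma galois_hom:
  assumes "\<tau> \<in> carrier (galois_group emb)"
  shows "\<tau> (x + y) = \<tau> x + \<tau> y" "\<tau> (x * y) = \<tau> x * \<tau> y" "\<tau> 0 = 0"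
    "\<tau> 1 = 1" "\<tau> (- x) = - \<tau> x" "\<tau> x = \<tau> y \<longleftrightarrow> x = y" "\<tau> (emb c) = emb c"
proof -
  show add: "\<tau> (x + y) = \<tau> x + \<tau> y" and mult: "\<tau> (x * y) = \<tau> x * \<tau> y"
    and "\<tau> (emb c) = emb c" for x y c
    using assms by (auto simp: galois_group_def)
  show inj: "\<tau> x = \<tau> y \<longleftrightarrow> x = y" for x y
    using assms by (auto simp: galois_group_def Bij_def bij_def dest: injD)
  show 0: "\<tau> 0 = 0" using add[of 0 0] by (metis add_0 add_cancel_right_right)
  show "\<tau> 1 = 1" using mult[of 1 1] inj[of 1 0] 0 by simp
  show "\<tau> (- x) = - \<tau> x" using add[of x "- x"] 0 by (simp add: eq_neg_iff_add_eq_0 add.commute)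
qed

lemma sigma_pow_hom [simp]:
  "(\<sigma> ^^ i) (x + y) = (\<sigma> ^^ i) x + (\<sigma> ^^ i) y"
  "(\<sigma> ^^ i) (x * y) = (\<sigma> ^^ i) x * (\<sigma> ^^ i) y"
  "(\<sigma> ^^ i) 0 = 0" "(\<sigma> ^^ i) 1 = 1" "(\<sigma> ^^ i) (- x) = - (\<sigma> ^^ i) x"
  by (induction i) (simp_all add: galois_hom[OF sigma_galois])

lemma sigma_pow_eq_iff [simp]: "(\<sigma> ^^ i) x = (\<sigma> ^^ i) y \<longleftrightarrow> x = y"
  by (induction i) (simp_all add: galois_hom[OF sigma_galois])

lemma sigma_pow_eq_0 [simp]: "(\<sigma> ^^ i) x = 0 \<longleftrightarrow> x = 0"
  using sigma_pow_eq_iff[of i x 0] by simp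

lemma galois_commute_pow:
  "\<tau> \<in> carrier (galois_group emb) \<Longrightarrow> \<tau> ((\<sigma> ^^ i) x) = (\<sigma> ^^ i) (\<tau> x)"
  by (induction i) (simp_all add: galois_commute)

lemma coeff_twisted_mult:
  "coeff (twisted_mult \<sigma> g h) n = (\<Sum>i\<le>n. coeff g i * (\<sigma> ^^ i) (coeff h (n - i)))"
proof -
  let ?t = "\<lambda>i. coeff g i * (\<sigma> ^^ i) (coeff h (n - i))"
  have inner: "(\<Sum>j\<le>degree h. coeff (monom (coeff g i * (\<sigma> ^^ i) (coeff h j)) (i + j)) n) =
    (if i \<le> n then ?t i else 0)" for i
  proof -
    have "(\<Sum>j\<le>degree h. coeff (monom (coeff g i * (\<sigma> ^^ i) (coeff h j)) (i + j)) n) =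
      (\<Sum>j\<le>degree h. if j = n - i then if i \<le> n then ?t i else 0 else 0)"
      by (rule sum.cong) auto
    also have "\<dots> = (if i \<le> n then ?t i else 0)"
      by (auto simp: coeff_eq_0)
    finally show ?thesis .
  qed
  have "coeff (twisted_mult \<sigma> g h) n = (\<Sum>i\<le>degree g. if i \<le> n then ?t i else 0)"
    by (simp only: twisted_mult_def coeff_sum inner)
  also have "\<dots> = (\<Sum>i\<in>{..degree g} \<inter> {..n}. ?t i)"
    by (subst sum.inter_restrict) auto
  also have "\<dots> = (\<Sum>i\<le>n. ?t i)"
    by (rule sum.mono_neutral_left) (auto simp: coeff_eq_0)
  finally show ?thesis .
qed

lemma coeff_twisted_mult_divisor:
  "coeff (twisted_mult \<sigma> u (monom 1 m - [:a:])) n =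
    (if m \<le> n then coeff u (n - m) else 0) - coeff u n * (\<sigma> ^^ n) a"
proof -
  let ?f = "monom 1 m - [:a:] :: 'k poly"
  have f: "coeff ?f k = (if k = m then 1 else 0) - (if k = 0 then a else 0)" for k
    by (auto simp: coeff_const)
  have f': "(\<sigma> ^^ i) (coeff ?f k) = (if k = m then 1 else 0) - (if k = 0 then (\<sigma> ^^ i) a else 0)" for i k
    using m_ge_2 unfolding f by auto
  have "(\<Sum>i\<le>n. coeff u i * (\<sigma> ^^ i) (coeff ?f (n - i))) =
    (\<Sum>i\<le>n. if m \<le> n \<and> i = n - m then coeff u i else 0) -
    (\<Sum>i\<le>n. if i = n then coeff u i * (\<sigma> ^^ i) a else 0)"
    unfolding f' sum_subtractf[symmetric]
    by (rule sum.cong) (use m_ge_2 in \<open>auto simp: algebra_simps\<close>)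
  also have "\<dots> = (if m \<le> n then coeff u (n - m) else 0) - coeff u n * (\<sigma> ^^ n) a"
    by (cases "m \<le> n") simp_all
  finally show ?thesis by (simp only: coeff_twisted_mult)
qed

text \<open>The divisor has leading coefficient \<open>1\<close>, so the top coefficient of a nonzero \<open>u - u'\<close> would
  survive \<open>m\<close> places higher in the product, beyond the reach of the remainders.\<close>

lemma remainder_unique:
  assumes "twisted_mult \<sigma> u (monom 1 m - [:a:]) + r = twisted_mult \<sigma> u' (monom 1 m - [:a:]) + r'"
    and "degree r < m" "degree r' < m"
  shows "r = r'"
proof -
  let ?w = "u - u'"
  have rec: "coeff ?w (n - m) = coeff ?w n * (\<sigma> ^^ n) a" if "m \<le> n" for n
  proof -
    have "coeff r n = 0" "coeff r' n = 0" using assms(2,3) that by (auto simp: coeff_eq_0)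
    then show ?thesis
      using arg_cong[OF assms(1), of "\<lambda>p. coeff p n"] that
      by (simp add: coeff_twisted_mult_divisor algebra_simps)
  qed
  have "coeff ?w (degree ?w + m) = 0" by (rule coeff_eq_0) (use m_ge_2 in simp)
  then have "coeff ?w (degree ?w) = 0" using rec[of "degree ?w + m"] by (simp del: coeff_diff)
  then have "?w = 0" by (simp only: leading_coeff_0_iff)
  then have "u = u'" by simp
  with assms(1) show ?thesis by simp
qed

text \<open>The structure constant of the algebra. A product of \<open>x t\<^sup>i\<close> and \<open>y t\<^sup>j\<close> that ends up in degree
  \<open>n < m\<close> has either \<open>i + j = n\<close> or \<open>i + j = n + m\<close>. The second case occurs when \<open>i > n\<close>, and then
  \<open>t\<^sup>n\<^sup>+\<^sup>m\<close> is replaced by \<open>\<sigma>\<^sup>n(a) t\<^sup>n\<close>, its remainder modulo \<open>t\<^sup>m - a\<close>.\<close>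

definition wrap :: "nat \<Rightarrow> nat \<Rightarrow> 'k" where
  "wrap i n = (if i \<le> n then 1 else (\<sigma> ^^ n) a)"

text \<open>A product of two elements has degree at most \<open>2m - 2\<close>, so a single step of the division
  suffices: the coefficients from degree \<open>m\<close> on form the quotient. Indices are read cyclically, which
  turns the two ranges of the product formula into one sum.\<close>

lemma cyc_mult_spec:
  assumes "g \<in> A" "h \<in> A"
  shows "degree (g \<star> h) < m"
    and "n < m \<Longrightarrow> coeff (g \<star> h) n =
      (\<Sum>i<m. coeff g i * (\<sigma> ^^ i) (coeff h ((n + m - i) mod m)) * wrap i n)"
proof -
  let ?P = "twisted_mult \<sigma> g h"
  let ?u = "\<Sum>i<m. monom (coeff ?P (i + m)) i"
  let ?r = "\<Sum>n<m. monom (coeff ?P n + coeff ?P (n + m) * (\<sigma> ^^ n) a) n"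
  have g0: "coeff g i = 0" and h0: "coeff h i = 0" if "m \<le> i" for i
    using assms that by (auto simp: cyc_carrier_def coeff_eq_0)
  have P0: "coeff ?P (n + m) = 0" if "m \<le> n" for n
    unfolding coeff_twisted_mult
  proof (rule sum.neutral, rule ballI)
    fix i
    show "coeff g i * (\<sigma> ^^ i) (coeff h (n + m - i)) = 0"
      using that by (cases "m \<le> i") (simp_all add: g0 h0)
  qed
  have u: "coeff ?u i = coeff ?P (i + m)" for i
    by (simp add: coeff_sum P0)
  have r: "coeff ?r n = (if n < m then coeff ?P n + coeff ?P (n + m) * (\<sigma> ^^ n) a else 0)" for n
    by (simp add: coeff_sum)
  have deg: "degree ?r < m" using m_ge_2 by (intro degree_lessI) (auto simp: r)
  have split: "?P = twisted_mult \<sigma> ?u (monom 1 m - [:a:]) + ?r"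
    by (rule poly_eqI) (auto simp: coeff_twisted_mult_divisor u r P0)
  have mult: "g \<star> h = ?r"
    unfolding cyc_mult_def
  proof (rule the_equality)
    show "degree ?r < m \<and> (\<exists>u. ?P = twisted_mult \<sigma> u (monom 1 m - [:a:]) + ?r)"
      using deg split by blast
  next
    fix r assume "degree r < m \<and> (\<exists>u. ?P = twisted_mult \<sigma> u (monom 1 m - [:a:]) + r)"
    then obtain u' where u': "degree r < m" "?P = twisted_mult \<sigma> u' (monom 1 m - [:a:]) + r"
      by blast
    show "r = ?r" by (rule remainder_unique[OF HOL.trans[OF u'(2)[symmetric] split] u'(1) deg])
  qed
  show "degree (g \<star> h) < m" unfolding mult by (rule deg)
  assume n: "n < m"
  let ?t = "\<lambda>i. coeff g i * (\<sigma> ^^ i) (coeff h ((n + m - i) mod m)) * wrap i n"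
  have low: "coeff ?P n = (\<Sum>i\<le>n. ?t i)"
    unfolding coeff_twisted_mult
  proof (rule sum.cong)
    fix i assume "i \<in> {..n}"
    then have "(n + m - i) mod m = n - i" using n by (simp add: cyclic_index)
    then show "coeff g i * (\<sigma> ^^ i) (coeff h (n - i)) = ?t i"
      using \<open>i \<in> {..n}\<close> by (simp add: wrap_def)
  qed simp
  have "coeff ?P (n + m) = (\<Sum>i\<in>{n<..<m}. coeff g i * (\<sigma> ^^ i) (coeff h (n + m - i)))"
    unfolding coeff_twisted_mult
    by (rule sum.mono_neutral_right) (auto simp: g0 h0 not_less not_le)
  then have "coeff ?P (n + m) * (\<sigma> ^^ n) a =
      (\<Sum>i\<in>{n<..<m}. coeff g i * (\<sigma> ^^ i) (coeff h (n + m - i)) * (\<sigma> ^^ n) a)"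
    by (simp only: sum_distrib_right)
  also have "\<dots> = (\<Sum>i\<in>{n<..<m}. ?t i)"
    by (rule sum.cong) (use n in \<open>auto simp: cyclic_index wrap_def\<close>)
  finally have high: "coeff ?P (n + m) * (\<sigma> ^^ n) a = (\<Sum>i\<in>{n<..<m}. ?t i)" .
  with low have "coeff (g \<star> h) n = (\<Sum>i\<in>{..n} \<union> {n<..<m}. ?t i)"
    using n by (subst sum.union_disjoint) (auto simp: mult r)
  also have "{..n} \<union> {n<..<m} = {..<m}" using n by auto
  finally show "coeff (g \<star> h) n = (\<Sum>i<m. ?t i)" .
qed

lemma mult_closed [simp]: "g \<in> A \<Longrightarrow> h \<in> A \<Longrightarrow> g \<star> h \<in> A"
  using cyc_mult_spec(1) by (simp add: cyc_carrier_def)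

lemma A_eqI: "g \<in> A \<Longrightarrow> h \<in> A \<Longrightarrow> (\<And>n. n < m \<Longrightarrow> coeff g n = coeff h n) \<Longrightarrow> g = h"
  by (rule poly_eqI) (metis (mono_tags, lifting) coeff_eq_0 cyc_carrier_def mem_Collect_eq not_le
      order.strict_trans2)

lemma A_simps [simp]:
  "0 \<in> A" "1 \<in> A" "[:x:] \<in> A" "i < m \<Longrightarrow> monom x i \<in> A" "smult x g \<in> A \<longleftrightarrow> x = 0 \<or> g \<in> A"
  using m_ge_2 by (auto simp: cyc_carrier_def intro: le_less_trans[OF degree_monom_le])

lemma A_add [simp]: "g \<in> A \<Longrightarrow> h \<in> A \<Longrightarrow> g + h \<in> A"
  by (simp add: cyc_carrier_def degree_add_less)

lemma A_sum_monom [simp]: "(\<Sum>i<n. monom (f i) i) \<in> A" if "n \<le> m"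
  using that by (induction n) simp_all

lemma sum_coeff_monom: "g \<in> A \<Longrightarrow> (\<Sum>i<m. monom (coeff g i) i) = g"
  by (rule A_eqI) (simp_all add: coeff_sum)

lemma coeff_mult_monom:
  assumes "g \<in> A" "j < m" "n < m"
  shows "coeff (g \<star> monom y j) n =
    coeff g ((n + m - j) mod m) * (\<sigma> ^^ ((n + m - j) mod m)) y * wrap ((n + m - j) mod m) n"
proof -
  let ?i = "(n + m - j) mod m"
  have iff: "(n + m - i) mod m = j \<longleftrightarrow> i = ?i" if "i < m" for i
    using that assms(2,3) by (auto simp: cyclic_index)
  have "coeff (g \<star> monom y j) n =
    (\<Sum>i<m. coeff g i * (\<sigma> ^^ i) (coeff (monom y j) ((n + m - i) mod m)) * wrap i n)"
    using assms by (intro cyc_mult_spec(2)) simp_all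
  also have "\<dots> = (\<Sum>i<m. if i = ?i then coeff g i * (\<sigma> ^^ i) y * wrap i n else 0)"
  proof (rule sum.cong)
    fix i assume "i \<in> {..<m}"
    then have "coeff (monom y j) ((n + m - i) mod m) = (if i = ?i then y else 0)"
      using iff[of i] by (simp only: coeff_monom lessThan_iff eq_commute[of j])
    then show "coeff g i * (\<sigma> ^^ i) (coeff (monom y j) ((n + m - i) mod m)) * wrap i n =
      (if i = ?i then coeff g i * (\<sigma> ^^ i) y * wrap i n else 0)" by simp
  qed simp
  also have "\<dots> = coeff g ?i * (\<sigma> ^^ ?i) y * wrap ?i n"
    using m_ge_2 by (subst sum.delta) auto
  finally show ?thesis .
qed

lemma const_mult [simp]:
  assumes "g \<in> A"
  shows "[:x:] \<star> g = smult x g"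
proof (rule A_eqI)
  fix n assume n: "n < m"
  have "coeff ([:x:] \<star> g) n =
    (\<Sum>i<m. coeff [:x:] i * (\<sigma> ^^ i) (coeff g ((n + m - i) mod m)) * wrap i n)"
    using assms n by (intro cyc_mult_spec(2)) simp_all
  also have "\<dots> = (\<Sum>i<m. if i = 0 then x * coeff g n else 0)"
    by (rule sum.cong) (use n in \<open>auto simp: wrap_def coeff_const\<close>)
  finally have "coeff ([:x:] \<star> g) n = (\<Sum>i<m. if i = 0 then x * coeff g n else 0)" .
  then show "coeff ([:x:] \<star> g) n = coeff (smult x g) n" using n by simp
qed (use assms in simp_all)

lemma coeff_mult_const: "g \<in> A \<Longrightarrow> n < m \<Longrightarrow> coeff (g \<star> [:x:]) n = coeff g n * (\<sigma> ^^ n) x"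
  using coeff_mult_monom[of g 0 n x] m_ge_2 by (simp add: monom_0 wrap_def)

lemma monom_mult_t:
  assumes "Suc i < m"
  shows "monom x i \<star> monom y 1 = monom (x * (\<sigma> ^^ i) y) (Suc i)"
proof (rule A_eqI)
  fix n assume n: "n < m"
  show "coeff (monom x i \<star> monom y 1) n = coeff (monom (x * (\<sigma> ^^ i) y) (Suc i)) n"
    using assms n m_ge_2 by (auto simp: coeff_mult_monom cyclic_index wrap_def)
qed (use assms m_ge_2 in simp_all)

lemma monom_mult_complement:
  assumes "0 < i" "i < m"
  shows "monom x (m - i) \<star> monom y i = [:x * (\<sigma> ^^ (m - i)) y * a:]"
proof (rule A_eqI)
  fix n assume n: "n < m"
  show "coeff (monom x (m - i) \<star> monom y i) n = coeff [:x * (\<sigma> ^^ (m - i)) y * a:] n"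
    using assms n by (auto simp: coeff_mult_monom cyclic_index wrap_def coeff_const)
qed (use assms m_ge_2 in simp_all)

subsection \<open>The left nucleus\<close>

definition left_nucleus :: "'k poly set" where
  "left_nucleus = {u \<in> A. \<forall>g\<in>A. \<forall>h\<in>A. u \<star> g \<star> h = u \<star> (g \<star> h)}"

lemma smult_mult:
  assumes "g \<in> A" "h \<in> A"
  shows "smult x g \<star> h = smult x (g \<star> h)"
  using assms
  by (intro A_eqI) (simp_all add: cyc_mult_spec(2) sum_distrib_left mult.assoc)

text \<open>For \<open>0 < i < m\<close> compare the two ways to multiply \<open>u\<close>, \<open>t\<^sup>m\<^sup>-\<^sup>i\<close> and \<open>t\<^sup>i\<close>. In degree \<open>i\<close> one
  has coefficient \<open>u\<^sub>i a\<close> and the other \<open>u\<^sub>i \<sigma>\<^sup>i(a)\<close>, so that \<open>u\<^sub>i = 0\<close>. Thus the left nucleus,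
  a subset defined by the multiplication alone, is the field of constants \<open>K\<close>.\<close>

lemma left_nucleus_eq: "left_nucleus = range (\<lambda>x. [:x:])"
proof (intro equalityI subsetI)
  fix u assume u: "u \<in> left_nucleus"
  then have uA: "u \<in> A" by (simp add: left_nucleus_def)
  have "coeff u i = 0" if i: "0 < i" "i < m" for i
  proof -
    have "coeff (u \<star> monom 1 (m - i) \<star> monom 1 i) i = coeff (u \<star> monom 1 (m - i)) 0"
      using uA i by (simp add: coeff_mult_monom cyclic_index wrap_def)
    also have "\<dots> = coeff u i * a"
      using uA i by (simp add: coeff_mult_monom cyclic_index wrap_def)
    finally have "coeff u i * a = coeff (u \<star> monom 1 (m - i) \<star> monom 1 i) i" by simp
    also have "u \<star> monom 1 (m - i) \<star> monom 1 i = u \<star> [:a:]"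
      using u i monom_mult_complement[OF i, of 1 1] by (simp add: left_nucleus_def)
    also have "coeff (u \<star> [:a:]) i = coeff u i * (\<sigma> ^^ i) a"
      using uA i by (simp add: coeff_mult_const)
    finally show ?thesis using a_moved[OF i] by auto
  qed
  then have "u = [:coeff u 0:]"
    using uA by (intro A_eqI) (auto simp: coeff_const)
  then show "u \<in> range (\<lambda>x. [:x:])" by blast
qed (auto simp: left_nucleus_def smult_mult)

end

section \<open>Automorphisms\<close>

context nonassociative_cyclic_algebra
begin

abbreviation Aut :: "('k poly \<Rightarrow> 'k poly) monoid" where "Aut \<equiv> cyc_aut emb m \<sigma> a"

text \<open>The coefficient of \<open>(k t)\<^sup>n = k \<sigma>(k) \<dots> \<sigma>\<^sup>n\<^sup>-\<^sup>1(k) t\<^sup>n\<close> in the twisted polynomial ring. For \<open>n = m\<close> this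
  is the norm of \<open>k\<close>.\<close>

definition twisted_norm :: "nat \<Rightarrow> 'k \<Rightarrow> 'k" where
  "twisted_norm n k = (\<Prod>l<n. (\<sigma> ^^ l) k)"

lemma twisted_norm_simps [simp]:
  "twisted_norm 0 k = 1" "twisted_norm (Suc n) k = twisted_norm n k * (\<sigma> ^^ n) k"
  by (simp_all add: twisted_norm_def)

lemma twisted_norm_add: "twisted_norm (i + j) k = twisted_norm i k * (\<sigma> ^^ i) (twisted_norm j k)"
  by (induction j) (simp_all add: funpow_add mult.assoc)

lemma twisted_norm_eq_0 [simp]: "k \<noteq> 0 \<Longrightarrow> twisted_norm n k \<noteq> 0"
  by (induction n) simp_all

lemma twisted_norm_mult: "twisted_norm n (k * l) = twisted_norm n k * twisted_norm n l"
  by (simp add: twisted_norm_def prod.distrib)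

lemma twisted_norm_galois:
  "\<tau> \<in> carrier (galois_group emb) \<Longrightarrow> \<tau> (twisted_norm n k) = twisted_norm n (\<tau> k)"
  by (induction n) (simp_all add: galois_hom galois_commute_pow)

lemma twisted_norm_coboundary:
  "c \<noteq> 0 \<Longrightarrow> twisted_norm n (inverse c * \<sigma> c) = inverse c * (\<sigma> ^^ n) c"
proof (induction n)
  case (Suc n)
  have "(\<sigma> ^^ n) (inverse c) * (\<sigma> ^^ n) c = 1"
    using Suc.prems by (simp flip: sigma_pow_hom(2))
  then have "(\<sigma> ^^ n) c * (\<sigma> ^^ n) (inverse c * \<sigma> c) = (\<sigma> ^^ Suc n) c"
    by (simp add: funpow_swap1 flip: mult.assoc) (simp add: mult.commute)
  then show ?case using Suc by (simp add: mult.assoc)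
qed simp

text \<open>The only candidate for an automorphism that restricts to \<open>\<tau>\<close> on \<open>K\<close> and sends \<open>t\<close> to
  \<open>k t\<close>.\<close>

definition extend :: "('k \<Rightarrow> 'k) \<Rightarrow> 'k \<Rightarrow> 'k poly \<Rightarrow> 'k poly" where
  "extend \<tau> k = (\<lambda>p\<in>A. \<Sum>i<m. monom (\<tau> (coeff p i) * twisted_norm i k) i)"

lemma extend_closed [simp]: "p \<in> A \<Longrightarrow> extend \<tau> k p \<in> A"
  by (simp add: extend_def)

lemma coeff_extend [simp]:
  "p \<in> A \<Longrightarrow> i < m \<Longrightarrow> coeff (extend \<tau> k p) i = \<tau> (coeff p i) * twisted_norm i k"
  by (simp add: extend_def coeff_sum)

lemma carrier_Aut_iff:
  "G \<in> carrier Aut \<longleftrightarrow> G \<in> Bij A \<and> (\<forall>x\<in>A. \<forall>y\<in>A. G (x + y) = G x + G y) \<and>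
     (\<forall>c. \<forall>x\<in>A. G (smult (emb c) x) = smult (emb c) (G x)) \<and>
     (\<forall>x\<in>A. \<forall>y\<in>A. G (x \<star> y) = G x \<star> G y)"
  by (simp add: cyc_aut_def)

text \<open>On terms that multiply without reduction, multiplicativity is the cocycle rule for
  \<open>twisted_norm\<close>. When \<open>t\<^sup>m\<close> is replaced by \<open>a\<close>, it amounts to \<open>\<tau>(a) = N(k) a\<close>.\<close>

lemma extend_in_Aut:
  assumes \<tau>: "\<tau> \<in> carrier (galois_group emb)" and k: "k \<noteq> 0"
    and norm: "\<tau> a = twisted_norm m k * a"
  shows "extend \<tau> k \<in> carrier Aut"
  unfolding carrier_Aut_iff
proof (intro conjI ballI allI)
  note hom = galois_hom[OF \<tau>]
  have surj: "\<exists>y. \<tau> y = x" for x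
    using \<tau> by (auto simp: galois_group_def Bij_def bij_def surj_def) (metis)
  have "bij_betw (extend \<tau> k) A A"
  proof (rule bij_betw_imageI)
    show "inj_on (extend \<tau> k) A"
    proof (rule inj_onI)
      fix p p' assume p: "p \<in> A" "p' \<in> A" and eq: "extend \<tau> k p = extend \<tau> k p'"
      have "coeff p i = coeff p' i" if "i < m" for i
        using arg_cong[OF eq, of "\<lambda>p. coeff p i"] p that k by (simp add: hom(6))
      then show "p = p'" using p by (intro A_eqI)
    qed
    show "extend \<tau> k ` A = A"
    proof (intro equalityI subsetI)
      fix p assume p: "p \<in> A"
      define f where "f i = (SOME y. \<tau> y = coeff p i / twisted_norm i k)" for i
      have f: "\<tau> (f i) = coeff p i / twisted_norm i k" for i
        unfolding f_def using surj by (rule someI_ex)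
      have "extend \<tau> k (\<Sum>i<m. monom (f i) i) = p"
        by (rule A_eqI) (use p k in \<open>simp_all add: coeff_sum f\<close>)
      then show "p \<in> extend \<tau> k ` A" by (intro image_eqI[of _ _ "\<Sum>i<m. monom (f i) i"]) simp_all
    qed auto
  qed
  then show "extend \<tau> k \<in> Bij A" by (auto simp: Bij_def extend_def)
  fix p p' assume p: "p \<in> A"
  show "extend \<tau> k (smult (emb c) p) = smult (emb c) (extend \<tau> k p)" for c
    by (rule A_eqI) (use p in \<open>simp_all add: hom mult.assoc\<close>)
  assume p': "p' \<in> A"
  show "extend \<tau> k (p + p') = extend \<tau> k p + extend \<tau> k p'"
    by (rule A_eqI) (use p p' in \<open>simp_all add: hom algebra_simps\<close>)
  have tau_sum: "\<tau> (\<Sum>i<l. h i) = (\<Sum>i<l. \<tau> (h i))" for l :: nat and h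
    by (induction l) (simp_all add: hom)
  show "extend \<tau> k (p \<star> p') = extend \<tau> k p \<star> extend \<tau> k p'"
  proof (rule A_eqI)
    fix n assume n: "n < m"
    have wrap: "\<tau> (wrap i n) * twisted_norm n k =
      twisted_norm i k * (\<sigma> ^^ i) (twisted_norm ((n + m - i) mod m) k) * wrap i n" if "i < m" for i
    proof (cases "i \<le> n")
      case True
      then show ?thesis
        using twisted_norm_add[of i "n - i" k] n that by (simp add: wrap_def hom cyclic_index)
    next
      case False
      then have "twisted_norm i k * (\<sigma> ^^ i) (twisted_norm (n + m - i) k) = twisted_norm (n + m) k"
        using twisted_norm_add[of i "n + m - i" k] that by simp
      also have "\<dots> * (\<sigma> ^^ n) a = twisted_norm n k * (\<sigma> ^^ n) (\<tau> a)"
        by (simp add: twisted_norm_add norm mult.assoc)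
      finally show ?thesis
        using n that False by (simp add: wrap_def cyclic_index galois_commute_pow[OF \<tau>] mult.commute)
    qed
    have "coeff (extend \<tau> k (p \<star> p')) n =
      (\<Sum>i<m. \<tau> (coeff p i) * (\<sigma> ^^ i) (\<tau> (coeff p' ((n + m - i) mod m))) * (\<tau> (wrap i n) * twisted_norm n k))"
      using p p' n
      by (simp add: cyc_mult_spec(2) tau_sum hom galois_commute_pow[OF \<tau>] sum_distrib_right mult.assoc)
    also have "\<dots> = (\<Sum>i<m. coeff (extend \<tau> k p) i *
      (\<sigma> ^^ i) (coeff (extend \<tau> k p') ((n + m - i) mod m)) * wrap i n)"
    proof (rule sum.cong)
      fix i assume "i \<in> {..<m}"
      then have i: "i < m" by simp
      show "\<tau> (coeff p i) * (\<sigma> ^^ i) (\<tau> (coeff p' ((n + m - i) mod m))) * (\<tau> (wrap i n) * twisted_norm n k) =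
        coeff (extend \<tau> k p) i * (\<sigma> ^^ i) (coeff (extend \<tau> k p') ((n + m - i) mod m)) * wrap i n"
        unfolding wrap[OF i] using p p' i m_ge_2 by (simp add: ac_simps)
    qed simp
    also have "\<dots> = coeff (extend \<tau> k p \<star> extend \<tau> k p') n"
      using p p' n by (simp only: cyc_mult_spec(2) extend_closed)
    finally show "coeff (extend \<tau> k (p \<star> p')) n = coeff (extend \<tau> k p \<star> extend \<tau> k p') n" .
  qed (use p p' in simp_all)
qed

context
  fixes G
  assumes G: "G \<in> carrier Aut"
begin

lemma Aut_closed: "p \<in> A \<Longrightarrow> G p \<in> A"
  using G by (auto simp: carrier_Aut_iff dest: Bij_imp_funcset)

lemma Aut_eq_iff: "p \<in> A \<Longrightarrow> p' \<in> A \<Longrightarrow> G p = G p' \<longleftrightarrow> p = p'"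
  using G by (auto simp: carrier_Aut_iff Bij_def bij_betw_def dest: inj_onD)

lemma Aut_surj:
  assumes "p \<in> A"
  shows "\<exists>p'\<in>A. G p' = p"
proof -
  have "G ` A = A" using G by (simp add: carrier_Aut_iff Bij_def bij_betw_def)
  then have "p \<in> G ` A" using assms by simp
  then show ?thesis by blast
qed

lemma Aut_hom:
  "p \<in> A \<Longrightarrow> p' \<in> A \<Longrightarrow> G (p + p') = G p + G p'"
  "p \<in> A \<Longrightarrow> G (smult (emb c) p) = smult (emb c) (G p)"
  "p \<in> A \<Longrightarrow> p' \<in> A \<Longrightarrow> G (p \<star> p') = G p \<star> G p'"
  using G by (auto simp: carrier_Aut_iff)

lemma Aut_0: "G 0 = 0"
  using Aut_hom(1)[of 0 0] by (metis A_simps(1) add_0 add_cancel_right_right)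

lemma Aut_left_nucleus:
  assumes "u \<in> A"
  shows "G u \<in> left_nucleus \<longleftrightarrow> u \<in> left_nucleus"
proof -
  have eq: "G u \<star> G g \<star> G h = G u \<star> (G g \<star> G h) \<longleftrightarrow> u \<star> g \<star> h = u \<star> (g \<star> h)"
    if "g \<in> A" "h \<in> A" for g h
    using that assms by (simp add: Aut_eq_iff flip: Aut_hom(3))
  have "G u \<in> left_nucleus \<longleftrightarrow> (\<forall>g\<in>A. \<forall>h\<in>A. G u \<star> G g \<star> G h = G u \<star> (G g \<star> G h))"
    unfolding left_nucleus_def using Aut_closed Aut_surj assms by (auto) (metis)
  also have "\<dots> \<longleftrightarrow> u \<in> left_nucleus"
    using assms by (simp add: eq left_nucleus_def)
  finally show ?thesis .
qed

text \<open>An automorphism preserves the left nucleus, so it induces a map on the constants.\<close>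

definition "restriction x = coeff (G [:x:]) 0"

lemma G_const: "G [:x:] = [:restriction x:]"
proof -
  have "G [:x:] \<in> left_nucleus" by (simp add: Aut_left_nucleus) (simp add: left_nucleus_eq)
  then show ?thesis by (auto simp: left_nucleus_eq restriction_def)
qed

lemma restriction_galois: "restriction \<in> carrier (galois_group emb)"
proof -
  have add: "restriction (x + y) = restriction x + restriction y" for x y
    using Aut_hom(1)[of "[:x:]" "[:y:]"] by (simp add: G_const)
  have mult: "restriction (x * y) = restriction x * restriction y" for x y
    using Aut_hom(3)[of "[:x:]" "[:y:]"] by (simp add: G_const)
  have inj: "restriction x = restriction y \<longleftrightarrow> x = y" for x y
    using Aut_eq_iff[of "[:x:]" "[:y:]"] by (simp add: G_const)
  have 0: "restriction 0 = 0" using Aut_0 G_const[of 0] by simp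
  have 1: "restriction 1 = 1" using mult[of 1 1] inj[of 1 0] 0 by simp
  have emb: "restriction (emb c) = emb c" for c
    using Aut_hom(2)[of "[:1:]" c] by (simp add: G_const 1)
  have "\<exists>y. restriction y = x" for x
  proof -
    obtain p where p: "p \<in> A" "G p = [:x:]" using Aut_surj[of "[:x:]"] by auto
    then have "p \<in> left_nucleus" using Aut_left_nucleus[OF p(1)] by (simp add: left_nucleus_eq)
    then obtain y where "p = [:y:]" by (auto simp: left_nucleus_eq)
    then show ?thesis using p(2) G_const[of y] by auto
  qed
  then have "bij restriction" using inj by (auto simp: bij_def inj_def surj_def) metis
  then show ?thesis using add mult emb by (simp add: galois_group_def Bij_def)
qed

text \<open>Apply the automorphism to \<open>t x = \<sigma>(x) t\<close> with \<open>x\<close> chosen such that it is sent to \<open>a\<close>. If the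
  image of \<open>t\<close> has coefficient \<open>w\<^sub>n\<close> in degree \<open>n\<close>, then \<open>w\<^sub>n \<sigma>\<^sup>n(a) = \<sigma>(a) w\<^sub>n\<close>, which forces
  \<open>w\<^sub>n = 0\<close> except for \<open>n = 1\<close>.\<close>

lemma G_t:
  obtains k where "k \<noteq> 0" "G (monom 1 1) = monom k 1"
proof -
  let ?t = "monom 1 1 :: 'k poly"
  let ?w = "G ?t"
  have t: "?t \<in> A" using m_ge_2 by simp
  then have w: "?w \<in> A" by (rule Aut_closed)
  obtain x where x: "restriction x = a"
    using restriction_galois by (auto simp: galois_group_def Bij_def bij_def surj_def) (metis)
  have "?t \<star> [:x:] = [:\<sigma> x:] \<star> ?t"
    by (rule A_eqI) (use t in \<open>auto simp: coeff_mult_const\<close>)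
  then have "?w \<star> [:restriction x:] = [:restriction (\<sigma> x):] \<star> ?w"
    using Aut_hom(3)[of ?t "[:x:]"] Aut_hom(3)[of "[:\<sigma> x:]" ?t] t by (simp add: G_const)
  then have eq: "?w \<star> [:a:] = smult (\<sigma> a) ?w"
    using w galois_commute[OF restriction_galois] by (simp add: x)
  have "coeff ?w n = 0" if n: "n < m" "n \<noteq> 1" for n
  proof -
    have "coeff ?w n * (\<sigma> ^^ n) a = \<sigma> a * coeff ?w n"
      using arg_cong[OF eq, of "\<lambda>p. coeff p n"] w n by (simp add: coeff_mult_const)
    moreover have "(\<sigma> ^^ n) a \<noteq> \<sigma> a"
    proof (cases n)
      case 0
      then show ?thesis using a_moved[of 1] m_ge_2 by simp
    next
      case (Suc n')
      then show ?thesis using n a_moved[of n'] galois_hom(6)[OF sigma_galois] by simp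
    qed
    ultimately show ?thesis by simp
  qed
  then have "?w = monom (coeff ?w 1) 1"
    using w m_ge_2 by (intro A_eqI) auto
  moreover have "?w \<noteq> 0" using Aut_eq_iff[OF t, of 0] Aut_0 by simp
  ultimately show ?thesis using that by (metis monom_eq_0_iff)
qed

text \<open>The algebra is generated by \<open>K\<close> and \<open>t\<close>, so the automorphism is determined by the
  restriction to \<open>K\<close> and the image \<open>k t\<close> of \<open>t\<close>. The condition on \<open>k\<close> is the image of
  \<open>t\<^sup>m\<^sup>-\<^sup>1 t = a\<close>.\<close>

lemma G_extend:
  obtains k where "k \<noteq> 0" "restriction a = twisted_norm m k * a" "G = extend restriction k"
proof -
  obtain k where k: "k \<noteq> 0" "G (monom 1 1) = monom k 1" by (rule G_t)
  have pow: "G (monom 1 i) = monom (twisted_norm i k) i" if "i < m" for i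
    using that
  proof (induction i)
    case 0
    show ?case using G_const[of 1] galois_hom(4)[OF restriction_galois] by (simp add: monom_0)
  next
    case (Suc i)
    then have "monom 1 (Suc i) = monom 1 i \<star> monom 1 1" using monom_mult_t[of i 1 1] by simp
    then have "G (monom 1 (Suc i)) = G (monom 1 i) \<star> G (monom 1 1)"
      using Aut_hom(3)[of "monom 1 i" "monom 1 1"] Suc.prems m_ge_2 by simp
    then show ?case using Suc monom_mult_t[of i] by (simp add: k[simplified])
  qed
  obtain m' where m': "m = Suc m'" "0 < m'" using m_ge_2 by (cases m) auto
  have "monom 1 (m - 1) \<star> monom 1 1 = [:a:]" using monom_mult_complement[of 1 1 1] m_ge_2 by simp
  then have "[:restriction a:] = G (monom 1 (m - 1)) \<star> G (monom 1 1)"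
    using m_ge_2 by (simp add: G_const flip: Aut_hom(3))
  also have "\<dots> = [:twisted_norm (m - 1) k * (\<sigma> ^^ (m - 1)) k * a:]"
    using m_ge_2 pow[of "m - 1"] monom_mult_complement[of 1 _ k] by (simp add: k[simplified])
  finally have norm: "restriction a = twisted_norm m k * a" by (simp add: m')
  have "G p = extend restriction k p" if p: "p \<in> A" for p
  proof -
    have "G (\<Sum>i<n. monom (coeff p i) i) = (\<Sum>i<n. monom (restriction (coeff p i) * twisted_norm i k) i)"
      if "n \<le> m" for n
      using that
    proof (induction n)
      case 0
      show ?case by (simp add: Aut_0)
    next
      case (Suc n)
      have "monom (coeff p n) n = [:coeff p n:] \<star> monom 1 n"
        using Suc by (simp add: smult_monom)
      then have "G (monom (coeff p n) n) = monom (restriction (coeff p n) * twisted_norm n k) n"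
        using Suc by (simp add: Aut_hom(3) G_const pow smult_monom del: const_mult)
          (simp add: smult_monom)
      then show ?case using Suc by (simp add: Aut_hom(1))
    qed
    from this[of m] show ?thesis using p by (simp add: sum_coeff_monom extend_def)
  qed
  then have "G = extend restriction k"
    using G by (intro extensionalityI[of _ A]) (auto simp: carrier_Aut_iff Bij_def extend_def)
  with k(1) norm show ?thesis by (rule that)
qed

end

theorem carrier_Aut:
  "carrier Aut = {extend \<tau> k | \<tau> k. \<tau> \<in> carrier (galois_group emb) \<and> k \<noteq> 0 \<and> \<tau> a = twisted_norm m k * a}"
proof (intro equalityI subsetI)
  fix G assume G: "G \<in> carrier Aut"
  obtain k where "k \<noteq> 0" "restriction G a = twisted_norm m k * a" "G = extend (restriction G) k"
    by (rule G_extend[OF G])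
  then show "G \<in> {extend \<tau> k | \<tau> k. \<tau> \<in> carrier (galois_group emb) \<and> k \<noteq> 0 \<and> \<tau> a = twisted_norm m k * a}"
    using restriction_galois[OF G] by blast
qed (auto intro: extend_in_Aut)

lemma extend_inject:
  assumes "extend \<tau> k = extend \<tau>' k'" "\<tau> 1 = 1" "\<tau>' 1 = 1"
  shows "\<tau> = \<tau>'" "k = k'"
proof -
  show "\<tau> = \<tau>'"
  proof
    fix x
    show "\<tau> x = \<tau>' x"
      using arg_cong[OF assms(1), of "\<lambda>G. coeff (G [:x:]) 0"] m_ge_2 by simp
  qed
  show "k = k'"
    using arg_cong[OF assms(1), of "\<lambda>G. coeff (G (monom 1 1)) 1"] m_ge_2 assms(2,3) by simp
qed

lemma mult_Aut: "G \<in> carrier Aut \<Longrightarrow> G' \<in> carrier Aut \<Longrightarrow> G \<otimes>\<^bsub>Aut\<^esub> G' = compose A G G'"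
  by (simp add: cyc_aut_def BijGroup_def)

lemma one_Aut: "\<one>\<^bsub>Aut\<^esub> = extend (\<lambda>x. x) 1"
proof -
  have "twisted_norm i 1 = 1" for i by (induction i) simp_all
  then show ?thesis by (auto simp: cyc_aut_def BijGroup_def extend_def sum_coeff_monom)
qed

lemma extend_mult:
  assumes "extend \<tau> k \<in> carrier Aut" "extend \<tau>' k' \<in> carrier Aut" "\<tau> \<in> carrier (galois_group emb)"
  shows "extend \<tau> k \<otimes>\<^bsub>Aut\<^esub> extend \<tau>' k' = extend (\<lambda>x. \<tau> (\<tau>' x)) (\<tau> k' * k)"
proof -
  have "extend \<tau> k (extend \<tau>' k' p) = extend (\<lambda>x. \<tau> (\<tau>' x)) (\<tau> k' * k) p" if "p \<in> A" for p
    by (rule A_eqI)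
      (use that in \<open>simp_all add: galois_hom(2)[OF assms(3)] twisted_norm_mult twisted_norm_galois[OF assms(3)] mult.assoc\<close>)
  then show ?thesis
    unfolding mult_Aut[OF assms(1,2)] by (auto simp: compose_def extend_def fun_eq_iff)
qed

lemma group_Aut: "group Aut"
proof -
  let ?G = "BijGroup A"
  interpret B: group ?G by (rule group_BijGroup)
  have "subgroup (carrier Aut) ?G"
  proof (rule B.subgroupI)
    show "carrier Aut \<subseteq> carrier ?G" by (auto simp: carrier_Aut_iff BijGroup_def)
    have "(\<lambda>x. x) \<in> carrier (galois_group emb)"
      using id_Bij[of UNIV] by (simp add: galois_group_def restrict_def)
    moreover have "twisted_norm m 1 = 1" by (simp add: twisted_norm_def)
    ultimately have "extend (\<lambda>x. x) 1 \<in> carrier Aut" by (intro extend_in_Aut) simp_all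
    then show "carrier Aut \<noteq> {}" by blast
  next
    fix G assume G: "G \<in> carrier Aut"
    then have GB: "G \<in> Bij A" by (simp add: carrier_Aut_iff)
    let ?I = "inv_into A G"
    have "?I (x + y) = ?I x + ?I y" "?I (x \<star> y) = ?I x \<star> ?I y" if "x \<in> A" "y \<in> A" for x y
      using that Aut_hom(1,3)[OF G] by (auto intro!: Bij_inv_into_lemma[OF _ GB])
    moreover have "?I (smult (emb c) x) = smult (emb c) (?I x)" if "x \<in> A" for x c
      using that Aut_hom(2)[OF G]
      by (intro Bij_inv_into_lemma[of A G "\<lambda>_ x. smult (emb c) x" x x, OF _ GB]) auto
    ultimately show "inv\<^bsub>?G\<^esub> G \<in> carrier Aut"
      using restrict_inv_into_Bij[OF GB] Bij_inv_into_mem[OF GB]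
      by (simp add: inv_BijGroup[OF GB] carrier_Aut_iff)
  next
    fix G G' assume G: "G \<in> carrier Aut" "G' \<in> carrier Aut"
    then have "G \<in> Bij A" "G' \<in> Bij A" by (simp_all add: carrier_Aut_iff)
    then show "G \<otimes>\<^bsub>?G\<^esub> G' \<in> carrier Aut"
      using compose_Bij[of G A G'] Aut_hom[OF G(1)] Aut_hom[OF G(2)] Aut_closed[OF G(2)]
      by (simp add: BijGroup_def carrier_Aut_iff compose_def)
  qed
  from B.subgroup_imp_group[OF this] show ?thesis by (simp add: cyc_aut_def)
qed

text \<open>The twisted norms of \<open>c\<^sup>-\<^sup>1 \<sigma>(c)\<close> telescope.\<close>

lemma G_map_eq_extend: "c \<noteq> 0 \<Longrightarrow> G_map m \<sigma> c = extend (\<lambda>x. x) (inverse c * \<sigma> c)"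
  by (simp add: G_map_def extend_def twisted_norm_coboundary mult.assoc)

lemma G_map_inner:
  assumes "c \<noteq> 0"
  shows "is_inner m \<sigma> a (G_map m \<sigma> c)"
  unfolding is_inner_def
proof (intro bexI conjI ballI)
  show "[:inverse c:] \<star> [:c:] = 1" using assms by (simp add: one_pCons)
  show "G_map m \<sigma> c x = [:inverse c:] \<star> x \<star> [:c:]" if "x \<in> A" for x
    by (rule A_eqI)
      (use that assms in \<open>simp_all add: G_map_eq_extend twisted_norm_coboundary coeff_mult_const\<close>)
qed (use assms in simp_all)

end

section \<open>Recognizing the two presented groups\<close>

lemma (in group) ord_dvd_card_subgroup:
  assumes "subgroup H G" "x \<in> H"
  shows "ord x dvd card H"
proof -
  interpret H: group "G\<lparr>carrier := H\<rparr>" using assms(1) by (rule subgroup_imp_group)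
  have "x [^] card H = \<one>"
    using H.pow_order_eq_1[of x] assms by (simp add: Coset.order_def nat_pow_consistent[symmetric])
  then show ?thesis using assms by (simp add: pow_eq_id subgroup.mem_carrier)
qed

definition satisfies :: "('a, 'b) monoid_scheme \<Rightarrow> ('g \<Rightarrow> 'a) \<Rightarrow> ('g word \<times> 'g word) set \<Rightarrow> bool" where
  "satisfies G f R \<longleftrightarrow> range f \<subseteq> carrier G \<and> (\<forall>(l, r)\<in>R. word_value G f l = word_value G f r)"

text \<open>A bound that holds for every pair of elements satisfying the relations, in whatever group,
  holds in particular for the tautological pair in the presented group.\<close>

lemma (in group) presented_group_iso_by_order:
  fixes R :: "(gen word \<times> gen word) set"
  assumes fin: "finite (carrier G)"
    and f: "satisfies G f R" "generate G {f Gen_x, f Gen_y} = carrier G"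
    and bound: "\<And>(H :: gen word set monoid) g. group H \<Longrightarrow> satisfies H g R \<Longrightarrow>
      \<exists>S. finite S \<and> card S \<le> Coset.order G \<and> generate H {g Gen_x, g Gen_y} \<subseteq> S"
  shows "G \<cong> presented_group R"
proof -
  let ?P = "presented_group R"
  let ?g = "\<lambda>g. {w. word_eq R [(g, True)] w}"
  interpret P: group ?P by (rule group_presented_group)
  have "satisfies ?P ?g R"
    using word_class_in_carrier relation_in_presented_group by (fastforce simp: satisfies_def)
  from bound[OF P.group_axioms this] obtain S
    where S: "finite S" "card S \<le> Coset.order G" "generate ?P {?g Gen_x, ?g Gen_y} \<subseteq> S" by blast
  have "carrier ?P \<subseteq> generate ?P {?g Gen_x, ?g Gen_y}"
  proof
    fix A assume "A \<in> carrier ?P"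
    then obtain u where "A = {w. word_eq R u w}" by (rule carrier_presented_groupE)
    then have "A = word_value ?P ?g u" by (simp add: word_value_presented_group)
    then show "A \<in> generate ?P {?g Gen_x, ?g Gen_y}"
      using P.word_value_in_generate[of ?g u] by (simp add: range_gen)
  qed
  with S have "carrier ?P \<subseteq> S" by blast
  then have "finite (carrier ?P)" "card (carrier ?P) \<le> Coset.order G"
    using S card_mono[OF S(1)] by (auto intro: finite_subset order.trans)
  then show ?thesis
    using f by (intro presented_group_iso[OF fin]) (auto simp: satisfies_def range_gen)
qed

lemma (in group) satisfies_semidirect:
  fixes a n l :: nat
  shows "satisfies G f {(gen_pow Gen_x (int a), []), (gen_pow Gen_y (int n), []),
      (gen_pow Gen_y 1 @ gen_pow Gen_x 1 @ gen_pow Gen_y (- 1), gen_pow Gen_x (int l))} \<longleftrightarrow>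
    f Gen_x \<in> carrier G \<and> f Gen_y \<in> carrier G \<and>
    f Gen_x [^] a = \<one> \<and> f Gen_y [^] n = \<one> \<and> f Gen_y \<otimes> f Gen_x = f Gen_x [^] l \<otimes> f Gen_y"
proof (cases "range f \<subseteq> carrier G")
  case True
  then have xy: "f Gen_x \<in> carrier G" "f Gen_y \<in> carrier G" by auto
  have "f Gen_y \<otimes> (f Gen_x \<otimes> inv f Gen_y) = f Gen_x [^] l \<longleftrightarrow>
    f Gen_y \<otimes> f Gen_x = f Gen_x [^] l \<otimes> f Gen_y"
  proof -
    have "f Gen_y \<otimes> (f Gen_x \<otimes> inv f Gen_y) = f Gen_y \<otimes> f Gen_x \<otimes> inv f Gen_y"
      using xy by (simp add: m_assoc)
    then show ?thesis using xy by (metis inv_solve_right m_closed nat_pow_closed)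
  qed
  then show ?thesis
    using True xy
    by (simp add: satisfies_def word_value_append[OF True] word_value_gen_pow[OF True] int_pow_int int_pow_neg)
qed (auto simp: satisfies_def range_gen)

text \<open>The relation \<open>x\<^sup>-\<^sup>1 y x = y\<^sup>-\<^sup>1\<close> is rewritten without inverses as \<open>y x y = x\<close>.\<close>

lemma (in group) satisfies_dicyclic:
  fixes l :: nat
  shows "satisfies G f {(gen_pow Gen_y (2 * int l), []), (gen_pow Gen_x 2, gen_pow Gen_y (int l)),
      (gen_pow Gen_x (- 1) @ gen_pow Gen_y 1 @ gen_pow Gen_x 1, gen_pow Gen_y (- 1))} \<longleftrightarrow>
    f Gen_x \<in> carrier G \<and> f Gen_y \<in> carrier G \<and>
    f Gen_y [^] (2 * l) = \<one> \<and> f Gen_x [^] (2 :: nat) = f Gen_y [^] l \<and>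
    f Gen_y \<otimes> f Gen_x \<otimes> f Gen_y = f Gen_x"
proof (cases "range f \<subseteq> carrier G")
  case True
  then have xy: "f Gen_x \<in> carrier G" "f Gen_y \<in> carrier G" by auto
  have "inv f Gen_x \<otimes> (f Gen_y \<otimes> f Gen_x) = inv f Gen_y \<longleftrightarrow>
    f Gen_y \<otimes> f Gen_x \<otimes> f Gen_y = f Gen_x"
    using xy by (metis inv_closed inv_solve_left inv_solve_right m_closed)
  moreover have "f Gen_y [^] (2 * int l) = f Gen_y [^] (2 * l)"
    "f Gen_x [^] (2 :: int) = f Gen_x [^] (2 :: nat)"
    using int_pow_int[of G "f Gen_y" "2 * l"] int_pow_int[of G "f Gen_x" 2] by simp_all
  ultimately show ?thesis
    using True xy
    by (simp add: satisfies_def word_value_append[OF True] word_value_gen_pow[OF True] int_pow_int int_pow_neg)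
qed (auto simp: satisfies_def range_gen)

lemma (in group) iso_semidirect_cyclic_group:
  fixes a n l :: nat
  assumes fin: "finite (carrier G)" and xy: "x \<in> carrier G" "y \<in> carrier G"
    and gen: "generate G {x, y} = carrier G"
    and rel: "x [^] a = \<one>" "y [^] n = \<one>" "y \<otimes> x = x [^] l \<otimes> y"
    and order: "Coset.order G = a * n" "0 < a" "0 < n"
  shows "G \<cong> semidirect_cyclic_group a (int l) n"
  unfolding semidirect_cyclic_group_def
proof (rule presented_group_iso_by_order[OF fin, of "case_gen x y"], unfold gen.case)
  fix H :: "gen word set monoid" and g
  assume "group H" and sat: "satisfies H g {(gen_pow Gen_x (int a), []), (gen_pow Gen_y (int n), []),
      (gen_pow Gen_y 1 @ gen_pow Gen_x 1 @ gen_pow Gen_y (- 1), gen_pow Gen_x (int l))}"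
  then interpret H: group H by simp
  let ?S = "(\<lambda>(i, j). g Gen_x [^]\<^bsub>H\<^esub> i \<otimes>\<^bsub>H\<^esub> g Gen_y [^]\<^bsub>H\<^esub> j) ` ({..<a} \<times> {..<n})"
  have "generate H {g Gen_x, g Gen_y} \<subseteq> ?S"
    by (rule H.metacyclic_normal_form[where c = 0 and l = l])
      (use sat order(2,3) in \<open>simp_all add: H.satisfies_semidirect\<close>)
  moreover have "card ?S \<le> a * n" using card_image_le[of "{..<a} \<times> {..<n}"] by fastforce
  ultimately show "\<exists>S. finite S \<and> card S \<le> Coset.order G \<and> generate H {g Gen_x, g Gen_y} \<subseteq> S"
    unfolding order(1) by (intro exI[of _ ?S]) simp
qed (use xy gen rel in \<open>simp_all add: satisfies_semidirect\<close>)

lemma (in group) iso_dicyclic_group: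
  fixes l :: nat
  assumes fin: "finite (carrier G)" and xy: "x \<in> carrier G" "y \<in> carrier G"
    and gen: "generate G {x, y} = carrier G"
    and rel: "y [^] (2 * l) = \<one>" "x [^] (2 :: nat) = y [^] l" "y \<otimes> x \<otimes> y = x"
    and order: "Coset.order G = 2 * l * 2" "0 < l"
  shows "G \<cong> dicyclic_group l"
  unfolding dicyclic_group_def
proof (rule presented_group_iso_by_order[OF fin, of "case_gen x y"], unfold gen.case)
  fix H :: "gen word set monoid" and g
  assume "group H" and sat: "satisfies H g {(gen_pow Gen_y (2 * int l), []),
      (gen_pow Gen_x 2, gen_pow Gen_y (int l)),
      (gen_pow Gen_x (- 1) @ gen_pow Gen_y 1 @ gen_pow Gen_x 1, gen_pow Gen_y (- 1))}"
  then interpret H: group H by simp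
  let ?x = "g Gen_x" and ?y = "g Gen_y"
  have r: "?x \<in> carrier H" "?y \<in> carrier H" "?y [^]\<^bsub>H\<^esub> (2 * l) = \<one>\<^bsub>H\<^esub>"
    "?x [^]\<^bsub>H\<^esub> (2 :: nat) = ?y [^]\<^bsub>H\<^esub> l" "?y \<otimes>\<^bsub>H\<^esub> ?x \<otimes>\<^bsub>H\<^esub> ?y = ?x"
    using sat by (simp_all only: H.satisfies_dicyclic)
  have "?y [^]\<^bsub>H\<^esub> (2 * l - 1) \<otimes>\<^bsub>H\<^esub> ?y = \<one>\<^bsub>H\<^esub>"
    using r(3) order(2) H.nat_pow_Suc[of ?y "2 * l - 1"] by simp
  then have "?y [^]\<^bsub>H\<^esub> (2 * l - 1) = inv\<^bsub>H\<^esub> ?y" using r(2) by (intro H.inv_equality[symmetric]) auto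
  then have "?x \<otimes>\<^bsub>H\<^esub> ?y = ?y [^]\<^bsub>H\<^esub> (2 * l - 1) \<otimes>\<^bsub>H\<^esub> ?x"
    using r(1,2,5) by (metis H.inv_solve_left H.m_assoc H.m_closed)
  note normal_form = H.metacyclic_normal_form[OF r(2,1) _ _ r(3,4) this]
  let ?S = "(\<lambda>(i, j). ?y [^]\<^bsub>H\<^esub> i \<otimes>\<^bsub>H\<^esub> ?x [^]\<^bsub>H\<^esub> j) ` ({..<2 * l} \<times> {..<2 :: nat})"
  have "generate H {?x, ?y} \<subseteq> ?S" using normal_form order(2) by (simp add: insert_commute)
  moreover have "card ?S \<le> 2 * l * 2" using card_image_le[of "{..<2 * l} \<times> {..<2 :: nat}"] by fastforce
  ultimately show "\<exists>S. finite S \<and> card S \<le> Coset.order G \<and> generate H {?x, ?y} \<subseteq> S"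
    unfolding order(1) by (intro exI[of _ ?S]) simp
qed (use xy gen rel in \<open>simp_all add: satisfies_dicyclic\<close>)

section \<open>The three cases\<close>

locale finite_cyclic_algebra = cyclic_extension emb \<alpha> q m s \<sigma>
  for emb :: "'f::{field,finite} \<Rightarrow> 'k::{field,finite}" and \<alpha> q m s \<sigma> +
  fixes a :: 'k
  assumes a_notin: "a \<notin> range emb"
begin

sublocale alg: nonassociative_cyclic_algebra emb \<sigma> m a
proof
  fix \<tau> x assume "\<tau> \<in> carrier (galois_group emb)"
  then obtain j where "\<tau> = (\<lambda>x. x ^ (q ^ j))" by (rule galois_group_frobenius_power)
  moreover obtain r where r: "\<And>i x. (\<sigma> ^^ i) x = x ^ (q ^ (r * i))" using sigma_frobenius by blast
  have "\<sigma> x = x ^ (q ^ r)" for x using r[of 1 x] by simp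
  ultimately show "\<tau> (\<sigma> x) = \<sigma> (\<tau> x)" by (simp add: mult.commute flip: power_mult)
qed (use m_ge_2 sigma_galois sigma_pow_fixed a_notin in blast)+

sublocale Aut: group "cyc_aut emb m \<sigma> a" by (rule alg.group_Aut)

lemma a_nonzero: "a \<noteq> 0" using a_notin emb_0 by (metis rangeI)

text \<open>Every element of the Galois group is a Frobenius power, so an automorphism is given by a pair
  \<open>(j, k)\<close>: it restricts to \<open>x \<mapsto> x\<^sup>q\<^sup>^\<^sup>j\<close> on \<open>K\<close> and sends \<open>t\<close> to \<open>k t\<close>. The exponent \<open>j\<close> only
  matters modulo \<open>m\<close>, but is left unreduced so that exponents add under composition.\<close>

definition frob :: "nat \<Rightarrow> 'k \<Rightarrow> 'k poly \<Rightarrow> 'k poly" where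
  "frob j k = alg.extend (\<lambda>x. x ^ (q ^ j)) k"

lemma frob_in_Aut: "k \<noteq> 0 \<Longrightarrow> a ^ (q ^ j) = k ^ s * a \<Longrightarrow> frob j k \<in> carrier alg.Aut"
  unfolding frob_def
  by (rule alg.extend_in_Aut)
    (simp_all add: frobenius_power_in_galois_group alg.twisted_norm_def norm_eq_power)

lemma Aut_frob:
  assumes "G \<in> carrier alg.Aut"
  obtains j k where "j < m" "k \<noteq> 0" "a ^ (q ^ j) = k ^ s * a" "G = frob j k"
proof -
  obtain \<tau> k where \<tau>: "\<tau> \<in> carrier (galois_group emb)" and k: "k \<noteq> 0"
    "\<tau> a = alg.twisted_norm m k * a" "G = alg.extend \<tau> k"
    using assms unfolding alg.carrier_Aut by blast
  obtain j where "j < m" "\<tau> = (\<lambda>x. x ^ (q ^ j))" by (rule galois_group_frobenius_power[OF \<tau>])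
  with k show ?thesis
    using that by (simp add: frob_def alg.twisted_norm_def norm_eq_power)
qed

lemma frob_mult:
  assumes "frob i k \<in> carrier alg.Aut" "frob j l \<in> carrier alg.Aut"
  shows "frob i k \<otimes>\<^bsub>alg.Aut\<^esub> frob j l = frob (i + j) (l ^ (q ^ i) * k)"
  using alg.extend_mult[OF assms[unfolded frob_def] frobenius_power_in_galois_group]
  by (simp add: frob_def power_add mult.commute flip: power_mult)

lemma frob_one: "\<one>\<^bsub>alg.Aut\<^esub> = frob 0 1"
  by (simp add: frob_def alg.one_Aut)

lemma frob_m: "frob m k = frob 0 k"
  by (simp add: frob_def)

lemma frob_0_eq_iff: "frob 0 k = frob 0 l \<longleftrightarrow> k = l"
  unfolding frob_def using alg.extend_inject(2)[of "\<lambda>x. x ^ (q ^ 0)" k "\<lambda>x. x ^ (q ^ 0)" l] by auto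

lemma frob_1_neq_ext_0: "frob 1 k \<noteq> frob 0 l"
proof
  assume "frob 1 k = frob 0 l"
  then have "(\<lambda>x :: 'k. x ^ (q ^ 1)) = (\<lambda>x. x ^ (q ^ 0))"
    unfolding frob_def by (rule alg.extend_inject) simp_all
  then have "a ^ q = a" by (auto dest: fun_cong[of _ _ a])
  then show False using a_notin by (simp add: range_emb)
qed

lemma frob_0_in_Aut: "k ^ s = 1 \<Longrightarrow> frob 0 k \<in> carrier alg.Aut"
  using s_pos by (intro frob_in_Aut) (auto simp: power_0_left)

lemma frob_0_pow:
  assumes "k ^ s = 1"
  shows "frob 0 k [^]\<^bsub>alg.Aut\<^esub> n = frob 0 (k ^ n)"
proof (induction n)
  case (Suc n)
  have "(k ^ n) ^ s = 1" by (metis assms mult.commute power_mult power_one)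
  then show ?case using Suc assms by (simp add: frob_mult frob_0_in_Aut)
qed (simp add: frob_one)

lemma finite_Aut: "finite (carrier alg.Aut)"
proof (rule finite_subset)
  show "carrier alg.Aut \<subseteq> (\<lambda>(j, k). frob j k) ` ({..<m} \<times> UNIV)"
    by (auto elim!: Aut_frob)
qed simp

text \<open>The generator of the kernel of the norm; it is the parameter of \<open>G\<^sub>\<alpha>\<close>.\<close>

abbreviation \<beta> :: 'k where "\<beta> \<equiv> inverse \<alpha> * \<sigma> \<alpha>"

lemma beta_s: "\<beta> ^ s = 1" by (simp only: hilbert90_generator dvd_refl)

lemma G_alpha: "G_map m \<sigma> \<alpha> = frob 0 \<beta>"
  using alpha_nonzero by (simp add: alg.G_map_eq_extend frob_def)

lemma ord_G_alpha: "Aut.ord (frob 0 \<beta>) = s"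
  unfolding Aut.ord_unique[OF frob_0_in_Aut[OF beta_s]]
  by (simp only: frob_0_pow[OF beta_s] frob_one frob_0_eq_iff hilbert90_generator) simp

lemma frob_0_cases:
  assumes "k ^ s = 1"
  obtains n where "n < s" "frob 0 k = frob 0 \<beta> [^]\<^bsub>alg.Aut\<^esub> n"
  using root_of_unity_is_power[OF s_pos hilbert90_generator assms] frob_0_pow[OF beta_s] by metis

subsection \<open>The parameter is not an eigenvector\<close>

text \<open>Suppose that an automorphism restricts to a nontrivial \<open>x \<mapsto> x\<^sup>q\<^sup>^\<^sup>j\<close> on \<open>K\<close>. Then \<open>a\<close> is an
  eigenvector of this map, with the eigenvalue \<open>\<lambda> = k\<^sup>s\<close> in \<open>F\<close>. Since the map has order \<open>m\<close>, it
  follows that \<open>\<lambda>\<^sup>m = 1\<close>. All \<open>m\<close>-th roots of unity occur as eigenvalues of powers of \<open>d\<close>, so \<open>a\<close> is a multiple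
  of some \<open>d\<^sup>i\<close> by an element that the map fixes, that is, by an element of \<open>F\<close>. When this is excluded, only the
  automorphisms that fix \<open>K\<close> are left, and they are the powers of \<open>G\<^sub>\<alpha>\<close>.\<close>

lemma Aut_cyclic:
  assumes gen: "pure_generator emb m e d"
    and not_eigen: "\<And>i c. i < m \<Longrightarrow> c \<noteq> 0 \<Longrightarrow> a \<noteq> emb c * d ^ i"
    and "G \<in> carrier alg.Aut"
  obtains n where "n < s" "G = frob 0 \<beta> [^]\<^bsub>alg.Aut\<^esub> n"
proof -
  obtain j k where G: "j < m" "k \<noteq> 0" "a ^ (q ^ j) = k ^ s * a" "G = frob j k"
    using assms(3) by (rule Aut_frob)
  have "j = 0"
  proof (rule ccontr)
    assume "j \<noteq> 0"
    note d = pure_generatorD[OF gen]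
    have "d \<noteq> 0" using d(2) emb_0 by (metis rangeI)
    have "d ^ m \<in> range emb" using d(1) by simp
    then obtain \<omega> where w: "\<omega> ^ m = 1" "\<omega> \<noteq> 1" "\<And>j. d ^ (q ^ j) = \<omega> ^ j * d"
      using frobenius_eigenvalue d(2) by metis
    let ?l = "k ^ s"
    have "?l ^ (q - 1) = 1" using power_card_K[OF G(2)] by (simp only: order_K power_mult)
    then have "?l \<in> range emb" using range_emb_iff_power G(2) by simp
    then have "((\<lambda>x. x ^ q) ^^ j) ?l = ?l" by (induction j) (simp_all only: funpow.simps o_apply range_emb id_apply)
    then have fixed: "?l ^ (q ^ j) = ?l" by (simp only: frobenius_iterate)
    have iter: "((\<lambda>x. x ^ (q ^ j)) ^^ n) a = ?l ^ n * a" for n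
    proof (induction n)
      case (Suc n)
      have "(?l ^ n * a) ^ (q ^ j) = (?l ^ (q ^ j)) ^ n * a ^ (q ^ j)"
        by (simp only: power_mult_distrib power_mult[symmetric] ac_simps)
      then show ?case using Suc by (simp only: funpow.simps o_apply fixed G(3) power_Suc ac_simps)
    qed simp
    have "((\<lambda>x. x ^ (q ^ j)) ^^ n) a = a ^ (q ^ (j * n))" for n
      by (induction n) (simp_all add: power_add mult.commute flip: power_mult)
    with iter have "?l ^ m * a = a ^ (q ^ (j * m))" by metis
    also have "\<dots> = a" using frobenius_mod[of a "j * m"] by simp
    finally have lm: "?l ^ m = 1" using a_nonzero by simp
    have "\<omega> ^ j \<noteq> 1" using root_of_unity_order[OF prime_m w(1,2)] G(1) \<open>j \<noteq> 0\<close> nat_dvd_not_less by blast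
    moreover have "(\<omega> ^ j) ^ m = 1" using w(1) by (metis mult.commute power_mult power_one)
    ultimately obtain i where i: "i < m" "?l = (\<omega> ^ j) ^ i"
      using root_of_unity_is_power[of m "\<omega> ^ j" ?l] root_of_unity_order[OF prime_m] lm m_ge_2 by auto
    have "\<omega> \<noteq> 0" using w(1) m_ge_2 by (auto simp: power_0_left)
    have "(a / d ^ i) ^ (q ^ j) = a ^ (q ^ j) / (d ^ (q ^ j)) ^ i"
      by (simp only: power_divide power_mult[symmetric] mult.commute)
    also have "\<dots> = a / d ^ i"
      using \<open>\<omega> \<noteq> 0\<close> by (simp only: G(3) i w(3) power_mult_distrib) simp
    finally have "a / d ^ i \<in> range emb"
      using G(1) \<open>j \<noteq> 0\<close> by (intro frobenius_fixed_coprime coprime_less_m) auto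
    then obtain c where "a / d ^ i = emb c" by auto
    then have "a = emb c * d ^ i" using \<open>d \<noteq> 0\<close> by (simp add: field_simps)
    moreover from this have "c \<noteq> 0" using a_nonzero by auto
    ultimately show False using not_eigen i(1) by blast
  qed
  then have "k ^ s = 1" using G(3) a_nonzero by simp
  then show ?thesis using frob_0_cases that G(4) \<open>j = 0\<close> by metis
qed

lemma generate_G_alpha: "generate alg.Aut {frob 0 \<beta>} = {frob 0 \<beta> [^]\<^bsub>alg.Aut\<^esub> n | n :: nat. True}"
  using Aut.generate_pow_nat[OF frob_0_in_Aut[OF beta_s]] s_pos by (simp add: ord_G_alpha)

lemma not_eigenvector:
  assumes gen: "pure_generator emb m e d"
    and not_eigen: "\<And>i c. i < m \<Longrightarrow> c \<noteq> 0 \<Longrightarrow> a \<noteq> emb c * d ^ i"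
  shows "carrier alg.Aut = generate alg.Aut {G_map m \<sigma> \<alpha>}"
    and "alg.Aut \<cong> integer_mod_group s"
    and "G \<in> carrier alg.Aut \<Longrightarrow> is_inner m \<sigma> a G"
proof -
  let ?g = "frob 0 \<beta>"
  have g: "?g \<in> carrier alg.Aut" by (rule frob_0_in_Aut[OF beta_s])
  show "carrier alg.Aut = generate alg.Aut {G_map m \<sigma> \<alpha>}"
    unfolding G_alpha generate_G_alpha
    using Aut_cyclic[OF gen not_eigen] Aut.nat_pow_closed[OF g] by blast
  have pow_eq: "?g [^]\<^bsub>alg.Aut\<^esub> i = ?g [^]\<^bsub>alg.Aut\<^esub> j \<longleftrightarrow> int s dvd j - i" for i j :: int
    using Aut.int_pow_eq[OF g, of i j] by (simp add: ord_G_alpha)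
  have "(\<lambda>i. ?g [^]\<^bsub>alg.Aut\<^esub> i) \<in> iso (integer_mod_group s) alg.Aut"
  proof (rule isoI)
    show "(\<lambda>i. ?g [^]\<^bsub>alg.Aut\<^esub> i) \<in> hom (integer_mod_group s) alg.Aut"
    proof (rule homI)
      fix i j :: int
      have "?g [^]\<^bsub>alg.Aut\<^esub> ((i + j) mod int s) = ?g [^]\<^bsub>alg.Aut\<^esub> (i + j)"
        unfolding pow_eq by (simp add: minus_mod_eq_mult_div)
      then show "?g [^]\<^bsub>alg.Aut\<^esub> (i \<otimes>\<^bsub>integer_mod_group s\<^esub> j) =
        ?g [^]\<^bsub>alg.Aut\<^esub> i \<otimes>\<^bsub>alg.Aut\<^esub> ?g [^]\<^bsub>alg.Aut\<^esub> j"
        using g by (simp add: Aut.int_pow_mult)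
    qed (use g in simp)
    show "bij_betw (\<lambda>i. ?g [^]\<^bsub>alg.Aut\<^esub> i) (carrier (integer_mod_group s)) (carrier alg.Aut)"
    proof (rule bij_betw_imageI)
      show "inj_on (\<lambda>i. ?g [^]\<^bsub>alg.Aut\<^esub> i) (carrier (integer_mod_group s))"
      proof (rule inj_onI)
        fix i j :: int
        assume "i \<in> carrier (integer_mod_group s)" "j \<in> carrier (integer_mod_group s)"
          "?g [^]\<^bsub>alg.Aut\<^esub> i = ?g [^]\<^bsub>alg.Aut\<^esub> j"
        then have "int s dvd j - i" "0 \<le> i" "i < int s" "0 \<le> j" "j < int s"
          using s_pos by (simp_all add: pow_eq carrier_integer_mod_group)
        moreover from this(1) have "j mod int s = i mod int s" by (simp only: mod_eq_dvd_iff)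
        ultimately show "i = j" by simp
      qed
      show "(\<lambda>i. ?g [^]\<^bsub>alg.Aut\<^esub> i) ` carrier (integer_mod_group s) = carrier alg.Aut"
      proof (intro equalityI subsetI)
        fix G assume "G \<in> carrier alg.Aut"
        then obtain n where "n < s" "G = ?g [^]\<^bsub>alg.Aut\<^esub> n"
          using Aut_cyclic[OF gen not_eigen] by blast
        then show "G \<in> (\<lambda>i. ?g [^]\<^bsub>alg.Aut\<^esub> i) ` carrier (integer_mod_group s)"
          by (intro image_eqI[of _ _ "int n"]) (simp_all add: carrier_integer_mod_group int_pow_int)
      qed (use g in auto)
    qed
  qed
  then show "alg.Aut \<cong> integer_mod_group s"
    using group.iso_sym[OF group_integer_mod_group is_isoI] by blast
  assume "G \<in> carrier alg.Aut"
  then obtain n where "G = frob 0 (\<beta> ^ n)"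
    using Aut_cyclic[OF gen not_eigen] frob_0_pow[OF beta_s] by metis
  moreover have "\<sigma> (\<alpha> ^ n) = \<sigma> \<alpha> ^ n" for n
    by (induction n) (simp_all add: alg.galois_hom[OF sigma_galois])
  then have "\<beta> ^ n = inverse (\<alpha> ^ n) * \<sigma> (\<alpha> ^ n)"
    by (simp add: power_mult_distrib power_inverse)
  ultimately have "G = G_map m \<sigma> (\<alpha> ^ n)"
    using alpha_nonzero by (simp add: alg.G_map_eq_extend frob_def)
  then show "is_inner m \<sigma> a G" using alg.G_map_inner alpha_nonzero by simp
qed

subsection \<open>The parameter is an eigenvector\<close>

context
  fixes \<zeta> :: 'k
  assumes zeta_m: "\<zeta> ^ m = 1" and zeta_neq_1: "\<zeta> \<noteq> 1" and a_eigen: "a ^ q = \<zeta> * a"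
begin

lemma zeta_q: "\<zeta> ^ (q - 1) = 1"
  using root_of_unity_order[OF prime_m zeta_m zeta_neq_1] m_dvd by blast

lemma a_frobenius: "a ^ (q ^ j) = \<zeta> ^ j * a"
proof (induction j)
  case (Suc j)
  have z: "\<zeta> ^ q = \<zeta>" using zeta_q q_ge_2 by (simp add: power_eq_if[of \<zeta> q])
  have "a ^ (q ^ Suc j) = (\<zeta> ^ q) ^ j * a ^ q"
    using Suc by (metis mult.commute power_Suc power_mult power_mult_distrib)
  then show ?case by (simp add: z a_eigen)
qed simp

text \<open>There are \<open>m\<close> restrictions, and each is extended by at most \<open>s\<close> choices of \<open>k\<close>, namely the
  roots of \<open>X\<^sup>s - \<zeta>\<^sup>j\<close>.\<close>

lemma card_Aut_le: "card (carrier alg.Aut) \<le> m * s"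
proof -
  have "carrier alg.Aut \<subseteq> (\<Union>j<m. frob j ` {k. k ^ s = \<zeta> ^ j})"
    using a_nonzero by (auto elim!: Aut_frob simp: a_frobenius)
  then have "card (carrier alg.Aut) \<le> card (\<Union>j<m. frob j ` {k. k ^ s = \<zeta> ^ j})"
    by (intro card_mono) auto
  also have "\<dots> \<le> (\<Sum>j<m. card (frob j ` {k. k ^ s = \<zeta> ^ j}))" by (rule card_UN_le) simp
  also have "\<dots> \<le> (\<Sum>j<m. s)"
    using card_power_eq_le[OF s_pos] card_image_le order.trans by (intro sum_mono) blast
  finally show ?thesis by simp
qed

lemma subgroup_eq_Aut:
  assumes H: "subgroup H alg.Aut" and "m * s \<le> card H"
  shows "H = carrier alg.Aut" "Coset.order alg.Aut = m * s"
proof -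
  have "H \<subseteq> carrier alg.Aut" using H by (rule subgroup.subset)
  then show eq: "H = carrier alg.Aut"
    using assms(2) card_Aut_le by (intro card_seteq finite_Aut) auto
  then show "Coset.order alg.Aut = m * s" using assms(2) card_Aut_le by (simp add: Coset.order_def)
qed

text \<open>The Frobenius map itself extends to the algebra because \<open>\<zeta>\<close> is a norm.\<close>

lemma root_zeta:
  obtains k where "k \<noteq> 0" "k ^ s = \<zeta>" "frob 1 k \<in> carrier alg.Aut"
proof -
  obtain k where k: "k ^ s = \<zeta>" by (rule root_exists[OF zeta_q])
  then have "k \<noteq> 0" using s_pos zeta_m m_ge_2 by (auto simp: power_0_left)
  moreover have "a ^ (q ^ 1) = k ^ s * a" by (simp add: k a_eigen)
  ultimately show ?thesis using k that frob_in_Aut by blast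
qed

lemma frob_1_pow:
  assumes "frob 1 k \<in> carrier alg.Aut"
  shows "frob 1 k [^]\<^bsub>alg.Aut\<^esub> n = frob n (k ^ (\<Sum>l<n. q ^ l))"
proof (induction n)
  case (Suc n)
  have "frob n (k ^ (\<Sum>l<n. q ^ l)) \<in> carrier alg.Aut"
    using Aut.nat_pow_closed[OF assms, of n] by (simp only: Suc)
  then have "frob 1 k [^]\<^bsub>alg.Aut\<^esub> Suc n = frob (n + 1) (k ^ (q ^ n) * k ^ (\<Sum>l<n. q ^ l))"
    using assms by (simp only: Aut.nat_pow_Suc Suc frob_mult)
  then show ?case by (simp add: add.commute flip: power_add)
qed (simp add: frob_one)

text \<open>The \<open>m\<close>-th power of an extension of the Frobenius map fixes \<open>K\<close>; it
  multiplies \<open>t\<close> by the norm of \<open>k\<close>.\<close>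

lemma frob_1_pow_m: "frob 1 k \<in> carrier alg.Aut \<Longrightarrow> frob 1 k [^]\<^bsub>alg.Aut\<^esub> m = frob 0 (k ^ s)"
  by (simp only: frob_1_pow s_sum frob_m)

text \<open>Here \<open>s = q + 1\<close> is even. The cyclic group generated by \<open>y = G\<^sub>\<alpha>\<close> has order \<open>q + 1\<close> and does
  not contain the extension \<open>x\<close> of the Frobenius map, so the two generate a group of order at least
  \<open>2 (q + 1)\<close>, which is everything. The square of \<open>x\<close> fixes \<open>K\<close> and multiplies \<open>t\<close>
  by \<open>\<zeta> = -1\<close>, as does the power \<open>y\<^sup>s\<^sup>/\<^sup>2\<close>, and conjugation by \<open>x\<close> raises \<open>y\<close> to the power \<open>q \<equiv> -1\<close> modulo \<open>s\<close>.\<close>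

lemma dicyclic:
  assumes "m = 2"
  shows "Coset.order alg.Aut = 2 * q + 2" "alg.Aut \<cong> dicyclic_group ((q + 1) div 2)"
proof -
  obtain k where k: "k \<noteq> 0" "k ^ s = \<zeta>" and x: "frob 1 k \<in> carrier alg.Aut" by (rule root_zeta)
  let ?x = "frob 1 k" and ?y = "frob 0 \<beta>"
  have y: "?y \<in> carrier alg.Aut" by (rule frob_0_in_Aut[OF beta_s])
  have s: "s = q + 1" by (simp add: s_sum assms numeral_2_eq_2)
  have "odd q" using m_dvd q_ge_2 assms by (auto elim!: dvdE)
  then obtain h where h: "q = 2 * h + 1" by (rule oddE)
  define l where "l = h + 1"
  have l: "s = 2 * l" "(q + 1) div 2 = l" "0 < l" by (simp_all add: s h l_def)
  let ?H = "generate alg.Aut {?x, ?y}"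
  have H: "subgroup ?H alg.Aut" using x y by (intro Aut.generate_is_subgroup) auto
  have "generate alg.Aut {?y} \<subset> ?H"
  proof
    show "generate alg.Aut {?y} \<subseteq> ?H" by (rule Aut.mono_generate) auto
    have "?x \<notin> generate alg.Aut {?y}"
      by (auto simp: generate_G_alpha frob_0_pow[OF beta_s] frob_1_neq_ext_0[unfolded One_nat_def])
    moreover have "?x \<in> ?H" by (simp add: generate.incl)
    ultimately show "generate alg.Aut {?y} \<noteq> ?H" by blast
  qed
  then have "card (generate alg.Aut {?y}) < card ?H"
    using finite_subset[OF subgroup.subset[OF H] finite_Aut] by (rule psubset_card_mono[rotated])
  then have "s < card ?H" using Aut.generate_pow_card[OF y] by (simp only: ord_G_alpha)
  moreover have "s dvd card ?H"
    using Aut.ord_dvd_card_subgroup[OF H, of ?y] by (simp add: ord_G_alpha generate.incl)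
  ultimately obtain t where t: "card ?H = s * t" "s < s * t" by (auto elim!: dvdE)
  have "2 \<le> t"
  proof (rule ccontr)
    assume "\<not> 2 \<le> t"
    then have "s * t \<le> s * 1" by (intro mult_le_mono2) simp
    with t(2) show False by simp
  qed
  then have "m * s \<le> s * t" unfolding assms mult.commute[of 2 s] by (rule mult_le_mono2)
  then have "m * s \<le> card ?H" by (simp only: t(1))
  note eq = subgroup_eq_Aut[OF H this]
  show "Coset.order alg.Aut = 2 * q + 2" using eq(2) by (simp add: assms s)
  have "\<beta> ^ l \<noteq> 1"
    using hilbert90_generator[of l] l by (auto dest: dvd_imp_le)
  moreover have "(\<beta> ^ l) ^ 2 = 1" using beta_s by (simp add: l(1) mult.commute flip: power_mult)
  ultimately have ul: "\<beta> ^ l = - 1" by (simp only: power2_eq_1_iff) simp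
  have "\<zeta> = - 1" using zeta_m zeta_neq_1 by (simp add: assms power2_eq_1_iff)
  with ul have "?x [^]\<^bsub>alg.Aut\<^esub> m = ?y [^]\<^bsub>alg.Aut\<^esub> l"
    using frob_1_pow_m[OF x] by (simp only: k(2) frob_0_pow[OF beta_s])
  then have xx: "?x [^]\<^bsub>alg.Aut\<^esub> (2 :: nat) = ?y [^]\<^bsub>alg.Aut\<^esub> l" unfolding assms .
  have "?y \<otimes>\<^bsub>alg.Aut\<^esub> ?x \<otimes>\<^bsub>alg.Aut\<^esub> ?y = frob 1 (\<beta> ^ q * (k * \<beta>))"
    using x y Aut.m_closed[OF y x] by (simp add: frob_mult)
  also have "\<beta> ^ q * (k * \<beta>) = \<beta> ^ s * k" by (simp add: s mult_ac)
  finally have "?y \<otimes>\<^bsub>alg.Aut\<^esub> ?x \<otimes>\<^bsub>alg.Aut\<^esub> ?y = ?x" by (simp only: beta_s mult_1_left)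
  moreover have "?y [^]\<^bsub>alg.Aut\<^esub> (2 * l) = \<one>\<^bsub>alg.Aut\<^esub>"
    by (simp only: frob_0_pow[OF beta_s] l(1)[symmetric] beta_s frob_one)
  ultimately show "alg.Aut \<cong> dicyclic_group ((q + 1) div 2)"
    unfolding l(2) using eq x y xx l
    by (intro Aut.iso_dicyclic_group[OF finite_Aut x y]) (simp_all add: assms)
qed

text \<open>Let \<open>y\<close> extend the Frobenius map. Its \<open>m\<close>-th power has order \<open>m\<close>, so \<open>y\<close> has order \<open>m\<^sup>2\<close>, and
  \<open>x = G\<^sub>\<alpha>\<^sup>m\<close> has order \<open>s / m\<close>. For odd \<open>m\<close> these orders are coprime, because \<open>m\<^sup>2\<close> does not divide
  \<open>s\<close>. By Lagrange \<open>x\<close> and \<open>y\<close> generate a group of order at least \<open>(s / m) m\<^sup>2 = m s\<close>, which is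
  everything; conjugation by \<open>y\<close> is the Frobenius map on the parameter of \<open>x\<close>, so it raises \<open>x\<close> to
  the power \<open>q\<close>.\<close>

lemma semidirect:
  assumes "m \<noteq> 2"
  shows "alg.Aut \<cong> semidirect_cyclic_group (s div m) (int q) (m ^ 2)"
proof -
  obtain k where k: "k \<noteq> 0" "k ^ s = \<zeta>" and y: "frob 1 k \<in> carrier alg.Aut" by (rule root_zeta)
  let ?x = "frob 0 (\<beta> ^ m)" and ?y = "frob 1 k"
  have um: "(\<beta> ^ m) ^ s = 1" using beta_s by (metis mult.commute power_mult power_one)
  have x: "?x \<in> carrier alg.Aut" by (rule frob_0_in_Aut[OF um])
  have "m > 0" "s = m * (s div m)" using m_ge_2 m_dvd_s by auto
  have "Aut.ord (frob 0 \<beta> [^]\<^bsub>alg.Aut\<^esub> m) = s div m"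
    using Aut.ord_pow[OF frob_0_in_Aut[OF beta_s], of m] m_dvd_s \<open>m > 0\<close> by (simp add: ord_G_alpha)
  then have ord_x: "Aut.ord ?x = s div m" by (simp only: frob_0_pow[OF beta_s])
  have zeta_s: "\<zeta> ^ s = 1" using root_of_unity_order[OF prime_m zeta_m zeta_neq_1] m_dvd_s by blast
  have ym: "?y [^]\<^bsub>alg.Aut\<^esub> m = frob 0 \<zeta>" using frob_1_pow_m[OF y] k(2) by simp
  have "?y [^]\<^bsub>alg.Aut\<^esub> (m ^ 2) = frob 0 \<zeta> [^]\<^bsub>alg.Aut\<^esub> m"
    unfolding ym[symmetric] using y by (simp add: Aut.nat_pow_pow power2_eq_square)
  then have ymm: "?y [^]\<^bsub>alg.Aut\<^esub> (m ^ 2) = \<one>\<^bsub>alg.Aut\<^esub>"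
    by (simp only: frob_0_pow[OF zeta_s] zeta_m frob_one)
  have ord_y: "Aut.ord ?y = m ^ 2"
  proof -
    have "Aut.ord ?y dvd m ^ 2" using ymm y by (simp add: Aut.pow_eq_id)
    then obtain i where i: "i \<le> 2" "Aut.ord ?y = m ^ i" using prime_m divides_primepow_nat by blast
    have "\<not> Aut.ord ?y dvd m"
      unfolding Aut.pow_eq_id[OF y, symmetric] ym frob_one frob_0_eq_iff by (rule zeta_neq_1)
    then have "i \<noteq> 0" "i \<noteq> 1" unfolding i(2) by (metis one_dvd power_0, metis dvd_refl power_one_right)
    with i show ?thesis by (cases "i = 2") auto
  qed
  let ?H = "generate alg.Aut {?x, ?y}"
  have H: "subgroup ?H alg.Aut" using x y by (intro Aut.generate_is_subgroup) auto
  have "Aut.ord ?x dvd card ?H" "Aut.ord ?y dvd card ?H"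
    by (rule Aut.ord_dvd_card_subgroup[OF H], simp add: generate.incl)+
  then have "s div m dvd card ?H" "m ^ 2 dvd card ?H" by (simp_all only: ord_x ord_y)
  moreover have "coprime (s div m) (m ^ 2)"
  proof -
    have "\<not> m dvd s div m"
      using not_m_squared_dvd_s[OF assms] m_dvd_s \<open>m > 0\<close> by (auto simp: power2_eq_square dvd_div_iff_mult)
    then have "coprime m (s div m)" using prime_imp_coprime[OF prime_m] by blast
    then show ?thesis by (simp add: coprime_commute)
  qed
  ultimately have "s div m * m ^ 2 dvd card ?H" by (intro divides_mult)
  moreover have order: "s div m * m ^ 2 = m * s"
    using m_dvd_s by (simp add: power2_eq_square flip: mult.assoc)
  moreover have "0 < card ?H"
    using finite_subset[OF subgroup.subset[OF H] finite_Aut] subgroup.one_closed[OF H] by (auto simp: card_gt_0_iff)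
  ultimately have "m * s \<le> card ?H" by (simp add: dvd_imp_le)
  note eq = subgroup_eq_Aut[OF H this]
  have "?y \<otimes>\<^bsub>alg.Aut\<^esub> ?x = frob 1 ((\<beta> ^ m) ^ q * k)"
    using frob_mult[OF y x] by simp
  moreover have "?x [^]\<^bsub>alg.Aut\<^esub> q \<otimes>\<^bsub>alg.Aut\<^esub> ?y = frob 1 (k * (\<beta> ^ m) ^ q)"
    using frob_mult[of 0 "(\<beta> ^ m) ^ q" 1 k] Aut.nat_pow_closed[OF x, of q] y
    by (simp add: frob_0_pow[OF um])
  ultimately have yx: "?y \<otimes>\<^bsub>alg.Aut\<^esub> ?x = ?x [^]\<^bsub>alg.Aut\<^esub> q \<otimes>\<^bsub>alg.Aut\<^esub> ?y"
    by (simp add: mult.commute)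
  show ?thesis
    by (rule Aut.iso_semidirect_cyclic_group[OF finite_Aut x y eq(1) _ ymm yx])
      (use eq(2) order s_pos m_dvd_s \<open>m > 0\<close> Aut.pow_ord_eq_1[OF x] in \<open>auto simp: ord_x elim!: dvdE\<close>)
qed

end

lemma eigenvector_multiple:
  assumes gen: "pure_generator emb m e d" and a: "a = emb c * d ^ i" "c \<noteq> 0" "0 < i" "i < m"
  obtains \<zeta> where "\<zeta> ^ m = 1" "\<zeta> \<noteq> 1" "a ^ q = \<zeta> * a"
proof -
  note d = pure_generatorD[OF gen]
  have "d ^ m \<in> range emb" using d(1) by simp
  then obtain \<omega> where w: "\<omega> ^ m = 1" "\<omega> \<noteq> 1" "\<And>j. d ^ (q ^ j) = \<omega> ^ j * d"
    using frobenius_eigenvalue d(2) by metis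
  have "emb c ^ q = emb c" using range_emb by blast
  moreover have "(d ^ i) ^ q = (d ^ q) ^ i" by (simp add: mult.commute flip: power_mult)
  ultimately have "a ^ q = \<omega> ^ i * a" using w(3)[of 1] by (simp add: a(1) power_mult_distrib)
  moreover have "(\<omega> ^ i) ^ m = 1" using w(1) by (metis mult.commute power_mult power_one)
  moreover have "\<omega> ^ i \<noteq> 1"
    using root_of_unity_order[OF prime_m w(1,2)] a(3,4) nat_dvd_not_less by blast
  ultimately show ?thesis using that by blast
qed

end

theorem theorem6p19:
  fixes emb :: "'f::{field,finite} \<Rightarrow> 'k::{field,finite}"
    and \<sigma> :: "'k \<Rightarrow> 'k"
    and \<alpha> a :: 'k
    and q m s :: nat
  assumes "field_embedding emb"
    and "card (UNIV :: 'f set) = q"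
    and "card (UNIV :: 'k set) = q ^ m"
    and "\<sigma> \<in> carrier (galois_group emb)"
    and "carrier (galois_group emb) = generate (galois_group emb) {\<sigma>}"
    and "s = (q ^ m - 1) div (q - 1)"
    and "- {0} = range (\<lambda>n :: int. \<alpha> powi n)"
    and "prime m"
    and "m dvd q - 1"
    and "a \<notin> range emb"
  shows
    "(\<exists>e d. pure_generator emb m e d) \<and>
     (\<forall>e d. pure_generator emb m e d \<longrightarrow>
        ((\<forall>i<m. \<forall>c. c \<noteq> 0 \<longrightarrow> a \<noteq> emb c * d ^ i) \<longrightarrow>
           carrier (cyc_aut emb m \<sigma> a) = generate (cyc_aut emb m \<sigma> a) {G_map m \<sigma> \<alpha>} \<and>
           cyc_aut emb m \<sigma> a \<cong> integer_mod_group s \<and>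
           (\<forall>G\<in>carrier (cyc_aut emb m \<sigma> a). is_inner m \<sigma> a G)) \<and>
        (m = 2 \<and> (\<exists>c. c \<noteq> 0 \<and> a = emb c * d) \<longrightarrow>
           Coset.order (cyc_aut emb m \<sigma> a) = 2 * q + 2 \<and>
           cyc_aut emb m \<sigma> a \<cong> dicyclic_group ((q + 1) div 2)) \<and>
        (m > 2 \<and> (\<exists>i\<in>{1..m - 1}. \<exists>c. c \<noteq> 0 \<and> a = emb c * d ^ i) \<longrightarrow>
           cyc_aut emb m \<sigma> a \<cong> semidirect_cyclic_group (s div m) (int q) (m ^ 2)))"
proof -
  interpret finite_cyclic_algebra emb \<alpha> q m s \<sigma> a
    using assms by unfold_locales
  show ?thesis
  proof (intro conjI allI impI)
    show "\<exists>e d. pure_generator emb m e d" by (rule pure_generator_exists)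
    fix e d assume gen: "pure_generator emb m e d"
    show "carrier (cyc_aut emb m \<sigma> a) = generate (cyc_aut emb m \<sigma> a) {G_map m \<sigma> \<alpha>}"
      "cyc_aut emb m \<sigma> a \<cong> integer_mod_group s"
      "\<forall>G\<in>carrier (cyc_aut emb m \<sigma> a). is_inner m \<sigma> a G"
      if "\<forall>i<m. \<forall>c. c \<noteq> 0 \<longrightarrow> a \<noteq> emb c * d ^ i"
      using not_eigenvector[OF gen] that by simp_all
    show "Coset.order (cyc_aut emb m \<sigma> a) = 2 * q + 2"
      "cyc_aut emb m \<sigma> a \<cong> dicyclic_group ((q + 1) div 2)"
      if "m = 2 \<and> (\<exists>c. c \<noteq> 0 \<and> a = emb c * d)"
    proof -
      from that obtain c where "m = 2" "c \<noteq> 0" "a = emb c * d ^ 1" by auto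
      then obtain \<zeta> where "\<zeta> ^ m = 1" "\<zeta> \<noteq> 1" "a ^ q = \<zeta> * a"
        using eigenvector_multiple[OF gen, of c 1] by auto
      from dicyclic[OF this \<open>m = 2\<close>]
      show "Coset.order (cyc_aut emb m \<sigma> a) = 2 * q + 2"
        "cyc_aut emb m \<sigma> a \<cong> dicyclic_group ((q + 1) div 2)" by simp_all
    qed
    show "cyc_aut emb m \<sigma> a \<cong> semidirect_cyclic_group (s div m) (int q) (m ^ 2)"
      if "m > 2 \<and> (\<exists>i\<in>{1..m - 1}. \<exists>c. c \<noteq> 0 \<and> a = emb c * d ^ i)"
    proof -
      from that obtain i c where i: "i \<in> {1..m - 1}" "c \<noteq> 0" "a = emb c * d ^ i" by blast
      obtain \<zeta> where "\<zeta> ^ m = 1" "\<zeta> \<noteq> 1" "a ^ q = \<zeta> * a"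
        by (rule eigenvector_multiple[OF gen i(3,2)]) (use i(1) that in auto)
      then show ?thesis using that by (intro semidirect) auto
    qed
  qed
qed

end
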